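(* For $z\in\mathbb D\setminus\{0\}$ and $j,k\ge0$, the $(j,k)$ block of the resolvent of the CMV matrix is $$[(\mathcal C-z)^{-1}]_{j,k}=\begin{cases}(2z)^{-1}\,\tilde x_j(z)\,\pi_k(z),& k>j\ \text{ or }\ j=k\text{ even},\\[2pt] (2z)^{-1}\,p_j(z)\,\chi_k(z),& j>k\ \text{ or }\ j=k\text{ odd}.\end{cases}$$
   Context: Fix $l\ge1$; $^\dagger$ is the Hermitian adjoint, $\mathbf 1$ the $l\times l$ identity, $\mathbb D$ the open unit disk. $d\mu$ is a positive semi-definite $l\times l$ matrix-valued measure on $\partial\mathbb D$ with $\mu(\partial\mathbb D)=\mathbf 1$; $\langle\!\langle f,g\rangle\!\rangle_R=\int f^\dagger\,d\mu\,g$, $\langle\!\langle f,g\rangle\!\rangle_L=\int g\,d\mu\,f^\dagger$ (integrals over $e^{i\theta}$). $\mu$ is non-trivial: $\operatorname{Tr}\langle\!\langle f,f\rangle\!\rangle_R>0$ for every non-zero matrix polynomial $f$. $\Phi_n^R,\Phi_n^L$ are the monic matrix polynomials of degree $n$ with $\langle\!\langle z^k\mathbf 1,\Phi_n^R\rangle\!\rangle_R=0$, $\langle\!\langle z^k\mathbf 1,\Phi_n^L\rangle\!\rangle_L=0$ for $0\le k<n$. $\varphi_n^R=\Phi_n^R\kappa_n^R$, $\varphi_n^L=\kappa_n^L\Phi_n^L$, with $\kappa_0^{R}=\kappa_0^L=\mathbf 1$, $\langle\!\langle\varphi_n^R,\varphi_n^R\rangle\!\rangle_R=\langle\!\langle\varphi_n^L,\varphi_n^L\rangle\!\rangle_L=\mathbf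 1$, $\kappa_{n+1}^L(\kappa_n^L)^{-1}>0$, $(\kappa_n^R)^{-1}\kappa_{n+1}^R>0$. For a matrix polynomial $P_n$ with index $n$, $P_n^*(z)=z^nP_n(1/\bar z)^\dagger$; $\varphi_n^{R,*}=(\varphi_n^R)^*$, etc. Second kind polynomials: $\psi_0^L=\psi_0^R=\mathbf 1$ and for $n\ge1$ $$\psi_n^L(z)=\int\frac{e^{i\theta}+z}{e^{i\theta}-z}(\varphi_n^L(e^{i\theta})-\varphi_n^L(z))\,d\mu(\theta),\quad \psi_n^R(z)=\int\frac{e^{i\theta}+z}{e^{i\theta}-z}\,d\mu(\theta)\,(\varphi_n^R(e^{i\theta})-\varphi_n^R(z)).$$ $F(z)=\int\frac{e^{i\theta}+z}{e^{i\theta}-z}\,d\mu(\theta)$. CMV basis: $\chi_{2n}(z)=z^{-n}\varphi_{2n}^{L,*}(z)$ ($n\ge0$), $\chi_{2n-1}(z)=z^{-n+1}\varphi_{2n-1}^R(z)$ ($n\ge1$). The CMV matrix is the block matrix $\mathcal C=(\mathcal C_{nm})_{n,m\ge0}$, $\mathcal C_{nm}=\langle\!\langle\chi_n,z\chi_m\rangle\!\rangle_R$; it defines a unitary operator on $\ell^2(\{0,1,2,\dots\};\mathbb C^l)$. Auxiliary functions: $\tilde x_n(z)=\chi_n(1/\bar z)^\dagger$; $\Upsilon_{2n}(z)=-z^{-n}\psi_{2n}^{L,*}(z)$, $\Upsilon_{2n-1}(z)=z^{-n+1}\psi_{2n-1}^R(z)$; $y_{2n}(z)=z^{-n}\psi_{2n}^L(z)$,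 $y_{2n-1}(z)=-z^{-n}\psi_{2n-1}^{R,*}(z)$; $p_n(z)=y_n(z)+\tilde x_n(z)F(z)$; $\pi_n(z)=\Upsilon_n(z)+F(z)\chi_n(z)$. *)

theory Defs
  imports "HOL-Analysis.Analysis" "HOL-Computational_Algebra.Polynomial"
begin

definition hadj :: "complex^'n^'m \<Rightarrow> complex^'m^'n" where
  "hadj A = map_matrix cnj (transpose A)"

definition cscale :: "complex \<Rightarrow> complex^'n^'m \<Rightarrow> complex^'n^'m"  (infixr "*\<^sub>C" 75) where
  "c *\<^sub>C A = map_matrix ((*) c) A"

definition qform :: "complex^'n^'n \<Rightarrow> complex^'n \<Rightarrow> complex" where
  "qform A v = (\<Sum>i\<in>UNIV. cnj (v $ i) * (A *v v) $ i)"

definition psd :: "complex^'n^'n \<Rightarrow> bool" where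
  "psd A \<longleftrightarrow> hadj A = A \<and> (\<forall>v. 0 \<le> Re (qform A v))"

definition posdef :: "complex^'n^'n \<Rightarrow> bool" where
  "posdef A \<longleftrightarrow> hadj A = A \<and> (\<forall>v. v \<noteq> 0 \<longrightarrow> 0 < Re (qform A v))"

definition circle :: "complex measure" where
  "circle = restrict_space borel (sphere 0 1)"

definition matrix_measure :: "(complex set \<Rightarrow> complex^'n^'n) \<Rightarrow> bool" where
  "matrix_measure \<mu> \<longleftrightarrow>
     (\<forall>A\<in>sets circle. psd (\<mu> A)) \<and>
     (\<forall>A::nat \<Rightarrow> complex set. range A \<subseteq> sets circle \<longrightarrow> disjoint_family A \<longrightarrow>
        (\<lambda>n. \<mu> (A n)) sums \<mu> (\<Union>n. A n))"

definition scalar_measure :: "(complex set \<Rightarrow> complex^'n^'n) \<Rightarrow> complex^'n \<Rightarrow> complex measure" where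
  "scalar_measure \<mu> v =
     measure_of (space circle) (sets circle) (\<lambda>A. ennreal (Re (qform (\<mu> A) v)))"

text \<open>
  Integration against the complex measure \<open>\<mu>\<^sub>a\<^sub>b(A) = \<mu> A $ a $ b\<close>. The library has no integral
  for complex measures, so \<open>\<mu>\<^sub>a\<^sub>b\<close> is decomposed into finite positive measures by polarization:
  \<open>\<mu>\<^sub>a\<^sub>b = 1/4 \<Sum>k<4. (-\<i>)\<^sup>k v\<^sub>k\<^sup>\<dagger> \<mu> v\<^sub>k\<close> with \<open>v\<^sub>k = e\<^sub>a + \<i>\<^sup>k e\<^sub>b\<close>; see \<open>entry_integral_indicator\<close>.
\<close>
definition entry_integral ::
    "(complex set \<Rightarrow> complex^'n^'n) \<Rightarrow> 'n \<Rightarrow> 'n \<Rightarrow> (complex \<Rightarrow> complex) \<Rightarrow> complex" where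
  "entry_integral \<mu> a b h =
     (\<Sum>k<4. (- \<i>) ^ k *
        (LINT x|scalar_measure \<mu> (axis a 1 + axis b (\<i> ^ k)). h x)) / 4"

lemma hadj_nth: "hadj A $ i $ j = cnj (A $ j $ i)"
  by (simp add: hadj_def map_matrix_def transpose_def)

lemma sums_qform:
  assumes "f sums M"
  shows "(\<lambda>n. Re (qform (f n) v)) sums Re (qform M v)"
proof -
  have "(\<lambda>n. f n $ i $ j) sums (M $ i $ j)" for i j
    using bounded_linear.sums[OF bounded_linear_vec_nth bounded_linear.sums[OF bounded_linear_vec_nth assms]] .
  then show ?thesis
    unfolding qform_def matrix_vector_mult_def
    by (intro sums_Re) (auto intro!: sums_sum sums_mult sums_mult2)
qed

lemma emeasure_scalar_measure:
  assumes "matrix_measure \<mu>" "A \<in> sets circle"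
  shows "emeasure (scalar_measure \<mu> v) A = ennreal (Re (qform (\<mu> A) v))"
proof -
  have ca: "(\<lambda>n. \<mu> (B n)) sums \<mu> (\<Union>n. B n)"
    if "range B \<subseteq> sets circle" "disjoint_family B" for B :: "nat \<Rightarrow> complex set"
    using assms(1) that by (auto simp: matrix_measure_def)
  have nn: "0 \<le> Re (qform (\<mu> B) v)" if "B \<in> sets circle" for B
    using assms(1) that by (auto simp: matrix_measure_def psd_def)
  have "(\<lambda>n::nat. \<mu> {}) sums \<mu> {}"
    using ca[of "\<lambda>_. {}"] by (auto simp: disjoint_family_on_def)
  then have "\<mu> {} = 0"
    using sums_summable summable_const_iff by blast
  then have pos: "positive (sets circle) (\<lambda>A. ennreal (Re (qform (\<mu> A) v)))"
    by (simp add: positive_def qform_def)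
  have cadd: "countably_additive (sets circle) (\<lambda>A. ennreal (Re (qform (\<mu> A) v)))"
    unfolding countably_additive_def
  proof (intro allI impI)
    fix B :: "nat \<Rightarrow> complex set"
    assume B: "range B \<subseteq> sets circle" "disjoint_family B"
    show "(\<Sum>n. ennreal (Re (qform (\<mu> (B n)) v))) = ennreal (Re (qform (\<mu> (\<Union>n. B n)) v))"
      using sums_qform[OF ca[OF B], of v] nn B(1)
      by (subst suminf_ennreal2) (auto simp: sums_iff)
  qed
  show ?thesis
    unfolding scalar_measure_def
    by (rule emeasure_measure_of_sigma[OF sets.sigma_algebra_axioms pos cadd assms(2)])
qed

lemma qform_polarization:
  assumes "hadj M = M"
  shows "(\<Sum>k<4. (- \<i>) ^ k * complex_of_real (Re (qform M (axis a 1 + axis b (\<i> ^ k))))) = 4 * M $ a $ b"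
proof -
  have q: "qform M (axis a 1 + axis b c) =
      M $ a $ a + cnj c * c * M $ b $ b + c * M $ a $ b + cnj c * M $ b $ a" for c
  proof -
    have ax: "axis i d $ j = (if j = i then d else 0)" for i j and d :: complex
      by (simp add: axis_def)
    have mv: "(M *v (axis a 1 + axis b c)) $ i = M $ i $ a + c * M $ i $ b" for i
      by (simp add: matrix_vector_mult_def ax distrib_left sum.distrib mult_if_delta
          if_distrib[of "\<lambda>x. y * x" for y] cong: if_cong)
    have "cnj ((axis a 1 + axis b c) $ i) = (if i = a then 1 else 0) + (if i = b then cnj c else 0)" for i
      by (simp add: ax)
    then show ?thesis
      unfolding qform_def mv
      by (simp add: distrib_right sum.distrib if_distrib[of "\<lambda>x. x * y" for y] cong: if_cong)
        (simp add: algebra_simps)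
  qed
  have h: "M $ b $ a = cnj (M $ a $ b)" "Im (M $ a $ a) = 0" "Im (M $ b $ b) = 0"
    using assms hadj_nth[of M b a] hadj_nth[of M a a] hadj_nth[of M b b]
    by (auto simp: complex_eq_iff)
  show ?thesis
    unfolding q
    by (simp add: h complex_eq_iff eval_nat_numeral)
qed

lemma entry_integral_indicator:
  assumes "matrix_measure \<mu>" "A \<in> sets circle"
  shows "entry_integral \<mu> a b (indicator A) = \<mu> A $ a $ b"
proof -
  have herm: "hadj (\<mu> A) = \<mu> A" and nn: "0 \<le> Re (qform (\<mu> A) v)" for v
    using assms by (auto simp: matrix_measure_def psd_def)
  have "(LINT x|scalar_measure \<mu> v. indicator A x) = complex_of_real (Re (qform (\<mu> A) v))" for v
  proof -
    have 1: "A \<inter> space (scalar_measure \<mu> v) = A"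
      using sets.sets_into_space[OF assms(2)] by (auto simp: scalar_measure_def space_measure_of_conv)
    have "A \<in> sets (scalar_measure \<mu> v)"
      using assms(2) by (simp add: scalar_measure_def)
    then have "(LINT x|scalar_measure \<mu> v. complex_of_real (indicator A x)) =
        complex_of_real (measure (scalar_measure \<mu> v) A)"
      using 1 by (subst integral_complex_of_real) simp
    then show ?thesis
      using emeasure_scalar_measure[OF assms, of v] nn[of v]
      by (simp add: measure_def indicator_def of_bool_def if_distrib cong: if_cong)
  qed
  then show ?thesis
    by (simp add: entry_integral_def qform_polarization[OF herm])
qed

text \<open>The integral \<open>\<integral> f d\<mu> g\<close>, with the measure between the two matrix factors.\<close>
definition mint ::
    "(complex set \<Rightarrow> complex^'n^'n) \<Rightarrow> (complex \<Rightarrow> complex^'n^'n) \<Rightarrow> (complex \<Rightarrow> complex^'n^'n)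
      \<Rightarrow> complex^'n^'n" where
  "mint \<mu> f g =
     (\<chi> i j. \<Sum>a\<in>UNIV. \<Sum>b\<in>UNIV. entry_integral \<mu> a b (\<lambda>x. f x $ i $ a * g x $ b $ j))"

definition ipR ::
    "(complex set \<Rightarrow> complex^'n^'n) \<Rightarrow> (complex \<Rightarrow> complex^'n^'n) \<Rightarrow> (complex \<Rightarrow> complex^'n^'n)
      \<Rightarrow> complex^'n^'n" where
  "ipR \<mu> f g = mint \<mu> (\<lambda>x. hadj (f x)) g"

definition ipL ::
    "(complex set \<Rightarrow> complex^'n^'n) \<Rightarrow> (complex \<Rightarrow> complex^'n^'n) \<Rightarrow> (complex \<Rightarrow> complex^'n^'n)
      \<Rightarrow> complex^'n^'n" where
  "ipL \<mu> f g = mint \<mu> g (\<lambda>x. hadj (f x))"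

text \<open>
  A matrix polynomial is a polynomial with matrix coefficients and a complex argument. The
  library's \<^const>\<open>poly\<close> is not usable for evaluation, because the type-class multiplication on
  vectors and matrices is componentwise.
\<close>
definition mpoly :: "(complex^'n^'n) poly \<Rightarrow> complex \<Rightarrow> complex^'n^'n" where
  "mpoly P z = (\<Sum>k\<le>degree P. z ^ k *\<^sub>C coeff P k)"

definition monic_of_degree :: "nat \<Rightarrow> (complex^'n^'n) poly \<Rightarrow> bool" where
  "monic_of_degree n P \<longleftrightarrow> degree P = n \<and> coeff P n = mat 1"

definition nontrivial_measure :: "(complex set \<Rightarrow> complex^'n^'n) \<Rightarrow> bool" where
  "nontrivial_measure \<mu> \<longleftrightarrow>
     (\<forall>f::(complex^'n^'n) poly. f \<noteq> 0 \<longrightarrow> 0 < Re (trace (ipR \<mu> (mpoly f) (mpoly f))))"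

definition monic_orthogonal_R ::
    "(complex set \<Rightarrow> complex^'n^'n) \<Rightarrow> (nat \<Rightarrow> (complex^'n^'n) poly) \<Rightarrow> bool" where
  "monic_orthogonal_R \<mu> \<Phi> \<longleftrightarrow>
     (\<forall>n. monic_of_degree n (\<Phi> n) \<and> (\<forall>k<n. ipR \<mu> (\<lambda>z. mat (z ^ k)) (mpoly (\<Phi> n)) = 0))"

definition monic_orthogonal_L ::
    "(complex set \<Rightarrow> complex^'n^'n) \<Rightarrow> (nat \<Rightarrow> (complex^'n^'n) poly) \<Rightarrow> bool" where
  "monic_orthogonal_L \<mu> \<Phi> \<longleftrightarrow>
     (\<forall>n. monic_of_degree n (\<Phi> n) \<and> (\<forall>k<n. ipL \<mu> (\<lambda>z. mat (z ^ k)) (mpoly (\<Phi> n)) = 0))"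

definition orthonormal_R ::
    "(nat \<Rightarrow> (complex^'n^'n) poly) \<Rightarrow> (nat \<Rightarrow> complex^'n^'n) \<Rightarrow> nat \<Rightarrow> complex \<Rightarrow> complex^'n^'n" where
  "orthonormal_R \<Phi> \<kappa> n z = mpoly (\<Phi> n) z ** \<kappa> n"

definition orthonormal_L ::
    "(nat \<Rightarrow> (complex^'n^'n) poly) \<Rightarrow> (nat \<Rightarrow> complex^'n^'n) \<Rightarrow> nat \<Rightarrow> complex \<Rightarrow> complex^'n^'n" where
  "orthonormal_L \<Phi> \<kappa> n z = \<kappa> n ** mpoly (\<Phi> n) z"

definition normalization_R ::
    "(complex set \<Rightarrow> complex^'n^'n) \<Rightarrow> (nat \<Rightarrow> (complex^'n^'n) poly) \<Rightarrow> (nat \<Rightarrow> complex^'n^'n) \<Rightarrow> bool"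
  where
  "normalization_R \<mu> \<Phi> \<kappa> \<longleftrightarrow>
     \<kappa> 0 = mat 1 \<and>
     (\<forall>n. ipR \<mu> (orthonormal_R \<Phi> \<kappa> n) (orthonormal_R \<Phi> \<kappa> n) = mat 1) \<and>
     (\<forall>n. posdef (matrix_inv (\<kappa> n) ** \<kappa> (Suc n)))"

definition normalization_L ::
    "(complex set \<Rightarrow> complex^'n^'n) \<Rightarrow> (nat \<Rightarrow> (complex^'n^'n) poly) \<Rightarrow> (nat \<Rightarrow> complex^'n^'n) \<Rightarrow> bool"
  where
  "normalization_L \<mu> \<Phi> \<kappa> \<longleftrightarrow>
     \<kappa> 0 = mat 1 \<and>
     (\<forall>n. ipL \<mu> (orthonormal_L \<Phi> \<kappa> n) (orthonormal_L \<Phi> \<kappa> n) = mat 1) \<and>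
     (\<forall>n. posdef (\<kappa> (Suc n) ** matrix_inv (\<kappa> n)))"

text \<open>
  The reversed polynomial with index \<open>n\<close>. For \<open>n > 0\<close> the value at \<open>z = 0\<close> is \<open>0\<close> instead of the
  value of the polynomial extension; below it is only evaluated at \<open>z \<noteq> 0\<close>.
\<close>
definition reversed :: "nat \<Rightarrow> (complex \<Rightarrow> complex^'n^'n) \<Rightarrow> complex \<Rightarrow> complex^'n^'n" where
  "reversed n P z = z ^ n *\<^sub>C hadj (P (1 / cnj z))"

text \<open>
  The first argument \<open>x\<close> is the integration variable \<open>e\<^sup>i\<^sup>\<theta>\<close>. The integral formulas below are only
  used off the unit circle, where the kernel has no singularity.
\<close>
definition kernel :: "complex \<Rightarrow> complex \<Rightarrow> complex" where
  "kernel x z = (x + z) / (x - z)"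

definition psiL ::
    "(complex set \<Rightarrow> complex^'n^'n) \<Rightarrow> (nat \<Rightarrow> complex \<Rightarrow> complex^'n^'n) \<Rightarrow> nat \<Rightarrow> complex \<Rightarrow> complex^'n^'n"
  where
  "psiL \<mu> \<phi>L n z =
     (if n = 0 then mat 1
      else mint \<mu> (\<lambda>x. kernel x z *\<^sub>C (\<phi>L n x - \<phi>L n z)) (\<lambda>x. mat 1))"

definition psiR ::
    "(complex set \<Rightarrow> complex^'n^'n) \<Rightarrow> (nat \<Rightarrow> complex \<Rightarrow> complex^'n^'n) \<Rightarrow> nat \<Rightarrow> complex \<Rightarrow> complex^'n^'n"
  where
  "psiR \<mu> \<phi>R n z =
     (if n = 0 then mat 1
      else mint \<mu> (\<lambda>x. mat (kernel x z)) (\<lambda>x. \<phi>R n x - \<phi>R n z))"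

definition Fcar :: "(complex set \<Rightarrow> complex^'n^'n) \<Rightarrow> complex \<Rightarrow> complex^'n^'n" where
  "Fcar \<mu> z = mint \<mu> (\<lambda>x. mat (kernel x z)) (\<lambda>x. mat 1)"

text \<open>
  In each definition \<open>n\<close> is the index of the function, and \<open>Suc n div 2\<close> is the \<open>m\<close> with
  \<open>n = 2m\<close> or \<open>n = 2m - 1\<close>.
\<close>
definition chi ::
    "(nat \<Rightarrow> complex \<Rightarrow> complex^'n^'n) \<Rightarrow> (nat \<Rightarrow> complex \<Rightarrow> complex^'n^'n) \<Rightarrow> nat \<Rightarrow> complex \<Rightarrow> complex^'n^'n"
  where
  "chi \<phi>L \<phi>R n z =
     (let m = int (Suc n div 2) in
      if even n then z powi (- m) *\<^sub>C reversed n (\<phi>L n) z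
      else z powi (- m + 1) *\<^sub>C \<phi>R n z)"

definition xtilde ::
    "(nat \<Rightarrow> complex \<Rightarrow> complex^'n^'n) \<Rightarrow> (nat \<Rightarrow> complex \<Rightarrow> complex^'n^'n) \<Rightarrow> nat \<Rightarrow> complex \<Rightarrow> complex^'n^'n"
  where
  "xtilde \<phi>L \<phi>R n z = hadj (chi \<phi>L \<phi>R n (1 / cnj z))"

definition Upsilon ::
    "(complex set \<Rightarrow> complex^'n^'n) \<Rightarrow> (nat \<Rightarrow> complex \<Rightarrow> complex^'n^'n) \<Rightarrow> (nat \<Rightarrow> complex \<Rightarrow> complex^'n^'n)
      \<Rightarrow> nat \<Rightarrow> complex \<Rightarrow> complex^'n^'n" where
  "Upsilon \<mu> \<phi>L \<phi>R n z =
     (let m = int (Suc n div 2) in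
      if even n then - (z powi (- m) *\<^sub>C reversed n (psiL \<mu> \<phi>L n) z)
      else z powi (- m + 1) *\<^sub>C psiR \<mu> \<phi>R n z)"

definition yfun ::
    "(complex set \<Rightarrow> complex^'n^'n) \<Rightarrow> (nat \<Rightarrow> complex \<Rightarrow> complex^'n^'n) \<Rightarrow> (nat \<Rightarrow> complex \<Rightarrow> complex^'n^'n)
      \<Rightarrow> nat \<Rightarrow> complex \<Rightarrow> complex^'n^'n" where
  "yfun \<mu> \<phi>L \<phi>R n z =
     (let m = int (Suc n div 2) in
      if even n then z powi (- m) *\<^sub>C psiL \<mu> \<phi>L n z
      else - (z powi (- m) *\<^sub>C reversed n (psiR \<mu> \<phi>R n) z))"

definition pfun ::
    "(complex set \<Rightarrow> complex^'n^'n) \<Rightarrow> (nat \<Rightarrow> complex \<Rightarrow> complex^'n^'n) \<Rightarrow> (nat \<Rightarrow> complex \<Rightarrow> complex^'n^'n)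
      \<Rightarrow> nat \<Rightarrow> complex \<Rightarrow> complex^'n^'n" where
  "pfun \<mu> \<phi>L \<phi>R n z = yfun \<mu> \<phi>L \<phi>R n z + xtilde \<phi>L \<phi>R n z ** Fcar \<mu> z"

definition pifun ::
    "(complex set \<Rightarrow> complex^'n^'n) \<Rightarrow> (nat \<Rightarrow> complex \<Rightarrow> complex^'n^'n) \<Rightarrow> (nat \<Rightarrow> complex \<Rightarrow> complex^'n^'n)
      \<Rightarrow> nat \<Rightarrow> complex \<Rightarrow> complex^'n^'n" where
  "pifun \<mu> \<phi>L \<phi>R n z = Upsilon \<mu> \<phi>L \<phi>R n z + Fcar \<mu> z ** chi \<phi>L \<phi>R n z"

definition CMV ::
    "(complex set \<Rightarrow> complex^'n^'n) \<Rightarrow> (nat \<Rightarrow> complex \<Rightarrow> complex^'n^'n) \<Rightarrow> (nat \<Rightarrow> complex \<Rightarrow> complex^'n^'n)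
      \<Rightarrow> nat \<Rightarrow> nat \<Rightarrow> complex^'n^'n" where
  "CMV \<mu> \<phi>L \<phi>R n m = ipR \<mu> (chi \<phi>L \<phi>R n) (\<lambda>z. z *\<^sub>C chi \<phi>L \<phi>R m z)"

definition ell2 :: "(nat \<Rightarrow> complex^'n) set" where
  "ell2 = {u. summable (\<lambda>n. (norm (u n))\<^sup>2)}"

definition matrix_op :: "(nat \<Rightarrow> nat \<Rightarrow> complex^'n^'n) \<Rightarrow> (nat \<Rightarrow> complex^'n) \<Rightarrow> nat \<Rightarrow> complex^'n" where
  "matrix_op B u n = (\<Sum>m. B n m *v u m)"

definition shifted_op ::
    "((nat \<Rightarrow> complex^'n) \<Rightarrow> nat \<Rightarrow> complex^'n) \<Rightarrow> complex \<Rightarrow> (nat \<Rightarrow> complex^'n) \<Rightarrow> nat \<Rightarrow> complex^'n"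
  where
  "shifted_op T z u n = T u n - z *s u n"

text \<open>
  The resolvent \<open>(T - z)\<^sup>-\<^sup>1\<close>, meaningful when \<open>T - z\<close> is a bijection of \<^const>\<open>ell2\<close> onto itself.
\<close>
definition resolvent ::
    "((nat \<Rightarrow> complex^'n) \<Rightarrow> nat \<Rightarrow> complex^'n) \<Rightarrow> complex \<Rightarrow> (nat \<Rightarrow> complex^'n) \<Rightarrow> nat \<Rightarrow> complex^'n"
  where
  "resolvent T z = inv_into ell2 (shifted_op T z)"

definition op_block :: "((nat \<Rightarrow> complex^'n) \<Rightarrow> nat \<Rightarrow> complex^'n) \<Rightarrow> nat \<Rightarrow> nat \<Rightarrow> complex^'n^'n" where
  "op_block T j k = matrix (\<lambda>v. T (\<lambda>n. if n = k then v else 0) j)"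

end

theory Submission
  imports Defs
begin

text \<open>
  In the orthonormal basis \<open>\<chi>\<^sub>0, \<chi>\<^sub>1, \<dots>\<close> of Laurent polynomials the CMV matrix represents multiplication by
  \<open>x\<close> on the unit circle, so its resolvent should have the blocks
  \<open>G\<^sub>j\<^sub>k = \<integral> \<chi>\<^sub>j(x)\<^sup>\<dagger> d\<mu>(x) (x - z)\<^sup>-\<^sup>1 \<chi>\<^sub>k(x)\<close>. The theorem follows by showing this and by evaluating the integrals.

  The functions \<open>\<chi>\<^sub>n\<close> arise by orthogonalizing the monomials \<open>1, x, x\<^sup>-\<^sup>1, x\<^sup>2, x\<^sup>-\<^sup>2, \<dots>\<close>. Multiplication by \<open>x\<close> or
  \<open>x\<^sup>-\<^sup>1\<close> advances at most two places in this list. So the CMV matrix \<open>C\<close> is a band matrix, and the relations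
  \<open>C\<^sup>\<dagger>C = C C\<^sup>\<dagger> = 1\<close> are finite Parseval sums for Laurent polynomials
  (\<open>mult_matrix_isometry\<close>). For a unitary band matrix, \<open>C - z\<close> is bijective on \<open>\<ell>\<^sup>2\<close> and its inverse is the
  Neumann series \<open>\<Sum>\<^sub>N z\<^sup>N (C\<^sup>\<dagger>)\<^sup>N\<^sup>+\<^sup>1\<close> (\<open>resolvent_sums\<close>). The blocks of \<open>(C\<^sup>\<dagger>)\<^sup>N\<^sup>+\<^sup>1\<close> are the integrals with
  \<open>x\<^sup>-\<^sup>N\<^sup>-\<^sup>1\<close> in place of \<open>(x - z)\<^sup>-\<^sup>1\<close>, and summing the geometric series under the integral gives \<open>G\<^sub>j\<^sub>k\<close>
  (\<open>op_block_resolvent\<close>).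

  The evaluation of \<open>G\<^sub>j\<^sub>k\<close> uses only orthogonality. If \<open>k > j\<close>, replace \<open>\<chi>\<^sub>j(x)\<^sup>\<dagger>\<close> in the integral by its
  continuation \<open>\<chi>\<^sub>j(1 / cnj z)\<^sup>\<dagger>\<close> to \<open>z\<close>: the error is the integral of a divided difference, a Laurent polynomial
  to which \<open>\<chi>\<^sub>k\<close> is orthogonal (\<open>green_upper\<close>). What remains is the Cauchy integral
  \<open>\<integral> d\<mu> (x - z)\<^sup>-\<^sup>1 \<chi>\<^sub>k\<close>, and this is \<open>\<pi>\<^sub>k(z) / (2 z)\<close> (\<open>pifun_eq\<close>): the second kind function is made so that adding \<open>F \<chi>\<^sub>k\<close>
  leaves an integral of \<open>\<phi>\<^sub>k\<close> against \<open>(x + z) / (x - z) = 1 + 2 z / (x - z)\<close>. For \<open>j > k\<close> the roles are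
  exchanged (\<open>green_lower\<close>, \<open>pfun_eq\<close>). On the diagonal, the parity of the index decides which of the two
  divided differences avoids the exponent, newly introduced at that index, to which \<open>\<chi>\<^sub>j\<close> is not orthogonal.
\<close>

section \<open>Complex matrices and the adjoint\<close>

lemma cscale_nth [simp]: "(c *\<^sub>C A) $ i $ j = c * A $ i $ j"
  by (simp add: cscale_def map_matrix_def)

lemma mat_nth: "mat c $ i $ j = (if i = j then c else 0)"
  by (simp add: mat_def)

lemma mat_eq_cscale: "mat c = c *\<^sub>C (mat 1 :: complex^'n^'n)"
  by (simp add: vec_eq_iff mat_nth)

lemma cscale_simps [simp]:
  "1 *\<^sub>C A = A" "0 *\<^sub>C A = 0" "c *\<^sub>C 0 = 0" "c *\<^sub>C (d *\<^sub>C A) = (c * d) *\<^sub>C A"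
  by (simp_all add: vec_eq_iff mult.assoc)

lemma cscale_linear:
  "c *\<^sub>C (A + B) = c *\<^sub>C A + c *\<^sub>C B" "c *\<^sub>C (A - B) = c *\<^sub>C A - c *\<^sub>C B"
  "(c + d) *\<^sub>C A = c *\<^sub>C A + d *\<^sub>C A" "(c - d) *\<^sub>C A = c *\<^sub>C A - d *\<^sub>C A"
  "c *\<^sub>C (- A) = - (c *\<^sub>C A)" "(- c) *\<^sub>C A = - (c *\<^sub>C A)"
  by (simp_all add: vec_eq_iff algebra_simps)

lemma cscale_sum: "c *\<^sub>C (\<Sum>i\<in>I. A i) = (\<Sum>i\<in>I. c *\<^sub>C A i)"
  by (simp add: vec_eq_iff sum_distrib_left)

lemma sum_cscale: "(\<Sum>i\<in>I. c i) *\<^sub>C A = (\<Sum>i\<in>I. c i *\<^sub>C A)"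
  by (simp add: vec_eq_iff sum_distrib_right)

lemma cscale_mult [simp]:
  fixes A :: "complex^'n^'m" and B :: "complex^'k^'n"
  shows "(c *\<^sub>C A) ** B = c *\<^sub>C (A ** B)" "A ** (c *\<^sub>C B) = c *\<^sub>C (A ** B)"
  by (simp_all add: vec_eq_iff matrix_matrix_mult_def sum_distrib_left mult_ac)

lemma matrix_mult_sum_left: "(\<Sum>i\<in>I. A i) ** (B :: complex^'k^'n) = (\<Sum>i\<in>I. A i ** B)"
  by (simp add: vec_eq_iff matrix_matrix_mult_def sum_distrib_right, subst sum.swap, simp)

lemma matrix_mult_sum_right: "(B :: complex^'k^'n) ** (\<Sum>i\<in>I. A i) = (\<Sum>i\<in>I. B ** A i)"
  by (simp add: vec_eq_iff matrix_matrix_mult_def sum_distrib_left, subst sum.swap, simp)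

lemma matrix_mult_add_left: "(A + B) ** (C :: complex^'k^'n) = A ** C + B ** C"
  by (simp add: vec_eq_iff matrix_matrix_mult_def distrib_right sum.distrib)

lemma matrix_mult_uminus [simp]:
  fixes A :: "complex^'n^'m" and B :: "complex^'k^'n"
  shows "(- A) ** B = - (A ** B)" "A ** (- B) = - (A ** B)"
  by (simp_all add: vec_eq_iff matrix_matrix_mult_def sum_negf)

lemma hadj_simps [simp]:
  "hadj (hadj A) = A" "hadj 0 = 0" "hadj (- A) = - hadj A" "hadj (c *\<^sub>C A) = cnj c *\<^sub>C hadj A"
  by (simp_all add: vec_eq_iff hadj_nth)

lemma hadj_mat [simp]: "hadj (mat c :: complex^'n^'n) = mat (cnj c)"
  by (simp add: vec_eq_iff hadj_nth mat_nth)

lemma hadj_diff: "hadj (A - B) = hadj A - hadj B"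
  by (simp add: vec_eq_iff hadj_nth)

lemma hadj_sum: "hadj (\<Sum>i\<in>I. A i) = (\<Sum>i\<in>I. hadj (A i))"
  by (simp add: vec_eq_iff hadj_nth)

lemma hadj_mult: "hadj (A ** B) = hadj B ** hadj A"
  by (simp add: vec_eq_iff hadj_nth matrix_matrix_mult_def mult.commute)

lemma invertible_hadj:
  fixes A :: "complex^'n^'n"
  assumes "invertible A"
  shows "invertible (hadj A)"
proof -
  obtain B where "A ** B = mat 1" "B ** A = mat 1"
    using assms unfolding invertible_def by blast
  then have "hadj B ** hadj A = mat 1" "hadj A ** hadj B = mat 1"
    by (simp_all flip: hadj_mult)
  then show ?thesis
    by (auto simp: invertible_def)
qed

lemma inner_hadj: "(A *v x) \<bullet> y = x \<bullet> (hadj A *v y)"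
  for A :: "complex^'n^'m"
proof -
  have "(A *v x) \<bullet> y = (\<Sum>i\<in>UNIV. \<Sum>j\<in>UNIV. (A $ i $ j * x $ j) \<bullet> (y $ i))"
    by (simp add: inner_vec_def matrix_vector_mult_def inner_sum_left)
  also have "\<dots> = (\<Sum>j\<in>UNIV. \<Sum>i\<in>UNIV. (A $ i $ j * x $ j) \<bullet> (y $ i))"
    by (rule sum.swap)
  also have "\<dots> = x \<bullet> (hadj A *v y)"
  proof -
    have "(A $ i $ j * x $ j) \<bullet> (y $ i) = x $ j \<bullet> (cnj (A $ i $ j) * y $ i)" for i j
      by (simp add: inner_complex_def algebra_simps)
    then show ?thesis
      by (simp add: inner_vec_def matrix_vector_mult_def inner_sum_right hadj_nth)
  qed
  finally show ?thesis .
qed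

lemma mult_vec_sum_right: "(A :: complex^'n^'m) *v (\<Sum>i\<in>I. x i) = (\<Sum>i\<in>I. A *v x i)"
  by (simp add: vec_eq_iff matrix_vector_mult_def sum_distrib_left, subst sum.swap, simp)

lemma mult_vec_sum_left: "(\<Sum>i\<in>I. A i) *v (x :: complex^'n) = (\<Sum>i\<in>I. A i *v x)"
  by (simp add: vec_eq_iff matrix_vector_mult_def sum_distrib_right, subst sum.swap, simp)

lemma cscale_mult_vec [simp]:
  "(c *\<^sub>C A) *v x = c *s (A *v x)" "A *v (c *s x) = c *s (A *v x)"
  for A :: "complex^'n^'m"
  by (simp_all add: vec_eq_iff matrix_vector_mult_def sum_distrib_left mult_ac)

lemma continuous_on_matrixI:
  fixes f :: "'a::topological_space \<Rightarrow> complex^'n^'m"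
  assumes "\<And>i j. continuous_on S (\<lambda>x. f x $ i $ j)"
  shows "continuous_on S f"
proof -
  have "continuous_on S (\<lambda>x. \<chi> i j. f x $ i $ j)"
    by (intro continuous_on_vec_lambda assms)
  then show ?thesis by (simp add: vec_lambda_eta)
qed

lemma continuous_on_entry [continuous_intros]:
  "continuous_on S f \<Longrightarrow> continuous_on S (\<lambda>x. f x $ i $ j)"
  for f :: "'a::topological_space \<Rightarrow> complex^'n^'m"
  by (intro continuous_on_component)

lemma continuous_on_cscale [continuous_intros]:
  "continuous_on S c \<Longrightarrow> continuous_on S f \<Longrightarrow> continuous_on S (\<lambda>x. c x *\<^sub>C f x)"
  by (rule continuous_on_matrixI) (simp add: continuous_intros)

lemma continuous_on_hadj [continuous_intros]:
  "continuous_on S f \<Longrightarrow> continuous_on S (\<lambda>x. hadj (f x))"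
  by (rule continuous_on_matrixI) (simp add: hadj_nth continuous_intros)

lemma continuous_on_matrix_mult [continuous_intros]:
  fixes f :: "'a::topological_space \<Rightarrow> complex^'n^'m" and g :: "'a \<Rightarrow> complex^'k^'n"
  shows "continuous_on S f \<Longrightarrow> continuous_on S g \<Longrightarrow> continuous_on S (\<lambda>x. f x ** g x)"
  by (rule continuous_on_matrixI) (simp add: matrix_matrix_mult_def continuous_intros)

section \<open>Integration against a matrix-valued measure\<close>

lemma space_scalar_measure [simp]: "space (scalar_measure \<mu> v) = sphere 0 1"
  by (simp add: scalar_measure_def space_measure_of_conv circle_def space_restrict_space)

lemma sets_scalar_measure [simp]: "sets (scalar_measure \<mu> v) = sets circle"
  by (simp add: scalar_measure_def)

lemma measurable_scalar_measure:
  fixes h :: "complex \<Rightarrow> complex"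
  assumes "continuous_on (sphere 0 1) h"
  shows "h \<in> borel_measurable (scalar_measure \<mu> v)"
proof -
  have "h \<in> borel_measurable circle"
    unfolding circle_def by (intro borel_measurable_continuous_on_restrict assms)
  then show ?thesis
    by (simp cong: measurable_cong_sets)
qed

lemma entry_integral_cong:
  assumes "\<And>x. x \<in> sphere 0 1 \<Longrightarrow> f x = g x"
  shows "entry_integral \<mu> a b f = entry_integral \<mu> a b g"
  unfolding entry_integral_def
  by (intro arg_cong[where f = "\<lambda>s. s / 4"] sum.cong refl arg_cong2[where f = "(*)"]
      Bochner_Integration.integral_cong) (use assms in auto)

lemma mint_cong:
  assumes "\<And>x. x \<in> sphere 0 1 \<Longrightarrow> f x = f' x" "\<And>x. x \<in> sphere 0 1 \<Longrightarrow> g x = g' x"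
  shows "mint \<mu> f g = mint \<mu> f' g'"
  unfolding mint_def vec_eq_iff vec_lambda_beta
  by (intro allI sum.cong refl entry_integral_cong) (simp add: assms)

text \<open>
  Scalars commute with the matrix-valued measure, so only the matrix factors of an integrand
  have a side.
\<close>
lemma mint_scalar_move: "mint \<mu> (\<lambda>x. c x *\<^sub>C f x) g = mint \<mu> f (\<lambda>x. c x *\<^sub>C g x)"
  by (simp add: mint_def mult_ac)

text \<open>
  On the circle every continuous function is bounded, hence integrable. Linearity of \<^const>\<open>mint\<close>
  is therefore stated throughout for integrands that are continuous on the circle.
\<close>
locale hermitian_measure =
  fixes \<mu> :: "complex set \<Rightarrow> complex^'n^'n"
  assumes measure: "matrix_measure \<mu>"
begin

lemma finite_measure_scalar: "finite_measure (scalar_measure \<mu> v)"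
proof
  have "sphere 0 1 \<in> sets circle"
    using sets.top[of circle] by (simp add: circle_def space_restrict_space)
  then show "emeasure (scalar_measure \<mu> v) (space (scalar_measure \<mu> v)) \<noteq> \<infinity>"
    by (simp add: emeasure_scalar_measure[OF measure])
qed

lemma integrable_scalar:
  fixes h :: "complex \<Rightarrow> complex"
  assumes h: "continuous_on (sphere 0 1) h"
  shows "integrable (scalar_measure \<mu> v) h"
proof -
  interpret finite_measure "scalar_measure \<mu> v" by (rule finite_measure_scalar)
  have "compact (h ` sphere 0 1)"
    by (intro compact_continuous_image h) simp
  then obtain B where "\<And>x. x \<in> sphere 0 1 \<Longrightarrow> norm (h x) \<le> B"
    by (meson bounded_iff compact_imp_bounded imageI)
  then show ?thesis
    by (intro integrable_const_bound[where B = B] AE_I2 measurable_scalar_measure h) auto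
qed

lemma entry_integral_add:
  assumes "continuous_on (sphere 0 1) f" "continuous_on (sphere 0 1) g"
  shows "entry_integral \<mu> a b (\<lambda>x. f x + g x) = entry_integral \<mu> a b f + entry_integral \<mu> a b g"
  unfolding entry_integral_def
  by (simp add: integrable_scalar[OF assms(1)] integrable_scalar[OF assms(2)]
      distrib_left sum.distrib add_divide_distrib)

lemma entry_integral_cmult:
  "entry_integral \<mu> a b (\<lambda>x. c * f x) = c * entry_integral \<mu> a b f"
  unfolding entry_integral_def by (simp add: sum_distrib_left mult_ac)

lemma entry_integral_sum:
  assumes "\<And>i. i \<in> I \<Longrightarrow> continuous_on (sphere 0 1) (f i)"
  shows "entry_integral \<mu> a b (\<lambda>x. \<Sum>i\<in>I. f i x) = (\<Sum>i\<in>I. entry_integral \<mu> a b (f i))"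
  using assms
proof (induction I rule: infinite_finite_induct)
  case (insert i I)
  then show ?case
    by (simp add: entry_integral_add continuous_on_sum)
qed (simp_all add: entry_integral_def)

lemma scalar_measure_scale:
  assumes "norm c = 1"
  shows "scalar_measure \<mu> (c *s v) = scalar_measure \<mu> v"
proof -
  have "qform M (c *s v) = qform M v" for M
  proof -
    have "cnj c * c = 1"
      using assms complex_norm_square[of c] by (simp add: mult.commute)
    moreover have "cnj (c * v $ i) * (c * w) = (cnj c * c) * (cnj (v $ i) * w)" for i w
      by (simp add: mult_ac)
    ultimately have "cnj (c * v $ i) * (c * w) = cnj (v $ i) * w" for i w
      by simp
    then show ?thesis
      unfolding qform_def vector_scalar_commute vector_smult_component by (simp only:)
  qed
  then show ?thesis
    by (simp add: scalar_measure_def)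
qed

text \<open>
  The polarization vectors \<open>e\<^sub>b + \<i>\<^sup>k e\<^sub>a\<close> and \<open>e\<^sub>a + \<i>\<^sup>-\<^sup>k e\<^sub>b\<close> differ by a unimodular factor and
  define the same scalar measure. Exchanging \<open>a\<close> and \<open>b\<close> thus amounts to \<open>k \<mapsto> -k\<close>, which
  conjugates the weights \<open>(-\<i>)\<^sup>k\<close>.
\<close>
lemma cnj_entry_integral:
  "cnj (entry_integral \<mu> a b h) = entry_integral \<mu> b a (\<lambda>x. cnj (h x))"
proof -
  have swap: "scalar_measure \<mu> (axis b 1 + axis a (cnj c)) = scalar_measure \<mu> (axis a 1 + axis b c)"
    if "norm c = 1" for c
  proof -
    have "cnj c * c = 1"
      using that complex_norm_square[of c] by (simp add: mult.commute)
    then have "axis b 1 + axis a (cnj c) = cnj c *s (axis a 1 + axis b c)"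
      by (simp add: vec_eq_iff axis_def)
    then show ?thesis
      using scalar_measure_scale[of "cnj c" "axis a 1 + axis b c"] that
      by (simp del: vector_add_ldistrib)
  qed
  have s0: "scalar_measure \<mu> (axis b 1 + axis a 1) = scalar_measure \<mu> (axis a 1 + axis b 1)"
    using swap[of 1] by simp
  have s1: "scalar_measure \<mu> (axis b 1 + axis a (- \<i>)) = scalar_measure \<mu> (axis a 1 + axis b \<i>)"
    using swap[of \<i>] by simp
  have s2: "scalar_measure \<mu> (axis b 1 + axis a (- 1)) = scalar_measure \<mu> (axis a 1 + axis b (- 1))"
    using swap[of "-1"] by simp
  have s3: "scalar_measure \<mu> (axis b 1 + axis a \<i>) = scalar_measure \<mu> (axis a 1 + axis b (- \<i>))"
    using swap[of "- \<i>"] by simp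
  show ?thesis
    by (simp add: entry_integral_def eval_nat_numeral s0 s1 s2 s3)
qed

lemma hadj_mint: "hadj (mint \<mu> f g) = mint \<mu> (\<lambda>x. hadj (g x)) (\<lambda>x. hadj (f x))"
proof -
  have "hadj (mint \<mu> f g) $ i $ j = mint \<mu> (\<lambda>x. hadj (g x)) (\<lambda>x. hadj (f x)) $ i $ j" for i j
    unfolding hadj_nth mint_def
    by (simp add: cnj_entry_integral mult.commute hadj_nth, subst sum.swap, simp)
  then show ?thesis by (simp add: vec_eq_iff)
qed

lemma mint_add_right:
  assumes "continuous_on (sphere 0 1) f" "continuous_on (sphere 0 1) g" "continuous_on (sphere 0 1) h"
  shows "mint \<mu> f (\<lambda>x. g x + h x) = mint \<mu> f g + mint \<mu> f h"
  by (simp add: vec_eq_iff mint_def distrib_left entry_integral_add continuous_intros assms sum.distrib)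

lemma mint_mult_right:
  assumes "continuous_on (sphere 0 1) f" "continuous_on (sphere 0 1) g"
  shows "mint \<mu> f (\<lambda>x. g x ** A) = mint \<mu> f g ** A"
proof -
  have e: "entry_integral \<mu> a b (\<lambda>x. f x $ i $ a * (\<Sum>k\<in>UNIV. g x $ b $ k * A $ k $ j)) =
      (\<Sum>k\<in>UNIV. entry_integral \<mu> a b (\<lambda>x. f x $ i $ a * g x $ b $ k) * A $ k $ j)" for i j a b
  proof -
    have "entry_integral \<mu> a b (\<lambda>x. f x $ i $ a * (\<Sum>k\<in>UNIV. g x $ b $ k * A $ k $ j)) =
      entry_integral \<mu> a b (\<lambda>x. \<Sum>k\<in>UNIV. A $ k $ j * (f x $ i $ a * g x $ b $ k))"
      by (simp add: sum_distrib_left mult_ac)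
    also have "\<dots> = (\<Sum>k\<in>UNIV. A $ k $ j * entry_integral \<mu> a b (\<lambda>x. f x $ i $ a * g x $ b $ k))"
      by (subst entry_integral_sum) (auto intro!: continuous_intros assms simp: entry_integral_cmult)
    finally show ?thesis by (simp add: mult.commute)
  qed
  have "mint \<mu> f (\<lambda>x. g x ** A) $ i $ j = (mint \<mu> f g ** A) $ i $ j" for i j
  proof -
    have "mint \<mu> f (\<lambda>x. g x ** A) $ i $ j = (\<Sum>a\<in>UNIV. \<Sum>b\<in>UNIV. \<Sum>k\<in>UNIV.
        entry_integral \<mu> a b (\<lambda>x. f x $ i $ a * g x $ b $ k) * A $ k $ j)"
      by (simp add: mint_def matrix_matrix_mult_def e)
    also have "\<dots> = (\<Sum>a\<in>UNIV. \<Sum>k\<in>UNIV. \<Sum>b\<in>UNIV.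
        entry_integral \<mu> a b (\<lambda>x. f x $ i $ a * g x $ b $ k) * A $ k $ j)"
      by (intro sum.cong refl sum.swap)
    also have "\<dots> = (\<Sum>k\<in>UNIV. \<Sum>a\<in>UNIV. \<Sum>b\<in>UNIV.
        entry_integral \<mu> a b (\<lambda>x. f x $ i $ a * g x $ b $ k) * A $ k $ j)"
      by (rule sum.swap)
    also have "\<dots> = (mint \<mu> f g ** A) $ i $ j"
      by (simp add: mint_def matrix_matrix_mult_def sum_distrib_right)
    finally show ?thesis .
  qed
  then show ?thesis by (simp add: vec_eq_iff)
qed

lemma mint_mult_left:
  assumes "continuous_on (sphere 0 1) f" "continuous_on (sphere 0 1) g"
  shows "mint \<mu> (\<lambda>x. A ** f x) g = A ** mint \<mu> f g"
proof -
  \<comment> \<open>Adjoints exchange the two sides of the measure.\<close>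
  have "hadj (mint \<mu> (\<lambda>x. A ** f x) g) = hadj (A ** mint \<mu> f g)"
    by (simp add: hadj_mint hadj_mult mint_mult_right continuous_intros assms)
  then show ?thesis by (metis hadj_simps(1))
qed

lemma mint_add_left:
  assumes "continuous_on (sphere 0 1) f" "continuous_on (sphere 0 1) g" "continuous_on (sphere 0 1) h"
  shows "mint \<mu> (\<lambda>x. f x + g x) h = mint \<mu> f h + mint \<mu> g h"
  by (simp add: vec_eq_iff mint_def distrib_right entry_integral_add continuous_intros assms sum.distrib)

lemma mint_zero [simp]: "mint \<mu> (\<lambda>x. 0) g = 0" "mint \<mu> f (\<lambda>x. 0) = 0"
  by (simp_all add: vec_eq_iff mint_def entry_integral_def)

lemma mint_cscale_right: "mint \<mu> f (\<lambda>x. c *\<^sub>C g x) = c *\<^sub>C mint \<mu> f g"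
  by (simp add: vec_eq_iff mint_def mult.left_commute entry_integral_cmult sum_distrib_left)

lemma mint_cscale_left: "mint \<mu> (\<lambda>x. c *\<^sub>C f x) g = c *\<^sub>C mint \<mu> f g"
  using mint_scalar_move[of \<mu> "\<lambda>_. c"] by (simp add: mint_cscale_right)

lemma mint_sum_right:
  assumes "continuous_on (sphere 0 1) f" "\<And>i. i \<in> I \<Longrightarrow> continuous_on (sphere 0 1) (g i)"
  shows "mint \<mu> f (\<lambda>x. \<Sum>i\<in>I. g i x) = (\<Sum>i\<in>I. mint \<mu> f (g i))"
  using assms(2)
proof (induction I rule: infinite_finite_induct)
  case (insert i I)
  then show ?case
    by (simp add: mint_add_right continuous_on_sum assms(1))
qed simp_all

lemma mint_sum_left:
  assumes "\<And>i. i \<in> I \<Longrightarrow> continuous_on (sphere 0 1) (f i)" "continuous_on (sphere 0 1) g"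
  shows "mint \<mu> (\<lambda>x. \<Sum>i\<in>I. f i x) g = (\<Sum>i\<in>I. mint \<mu> (f i) g)"
  using assms(1)
proof (induction I rule: infinite_finite_induct)
  case (insert i I)
  then show ?case
    by (simp add: mint_add_left continuous_on_sum assms(2))
qed simp_all

lemma mint_one: "mint \<mu> (\<lambda>x. mat 1) (\<lambda>x. mat 1) = \<mu> (sphere 0 1)"
proof -
  have "sphere 0 1 \<in> sets circle"
    using sets.top[of circle] by (simp add: circle_def space_restrict_space)
  from entry_integral_indicator[OF measure this]
  have e: "entry_integral \<mu> a b (\<lambda>x. 1) = \<mu> (sphere 0 1) $ a $ b" for a b
    using entry_integral_cong[of "\<lambda>x. 1" "indicator (sphere 0 1)" \<mu> a b] by simp
  have z: "entry_integral \<mu> a b (\<lambda>x. 0) = 0" for a b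
    by (simp add: entry_integral_def)
  have "entry_integral \<mu> a b (\<lambda>x. mat 1 $ i $ a * mat 1 $ b $ j) =
      (if b = j then if a = i then \<mu> (sphere 0 1) $ a $ b else 0 else 0)" for a b i j
    by (auto simp: mat_nth e z)
  then show ?thesis
    by (simp add: vec_eq_iff mint_def)
qed

lemma mint_tendsto:
  assumes f: "continuous_on (sphere 0 1) f" and g: "continuous_on (sphere 0 1) g"
    and c: "\<And>N. continuous_on (sphere 0 1) (c N)" "continuous_on (sphere 0 1) c'"
    and lim: "\<And>x. x \<in> sphere 0 1 \<Longrightarrow> (\<lambda>N. c N x) \<longlonglongrightarrow> c' x"
    and bound: "\<And>N x. x \<in> sphere 0 1 \<Longrightarrow> norm (c N x) \<le> B"
  shows "(\<lambda>N. mint \<mu> f (\<lambda>x. c N x *\<^sub>C g x)) \<longlonglongrightarrow> mint \<mu> f (\<lambda>x. c' x *\<^sub>C g x)"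
proof -
  have "(\<lambda>N. LINT x|scalar_measure \<mu> v. f x $ i $ a * (c N x * g x $ b $ j)) \<longlonglongrightarrow>
      (LINT x|scalar_measure \<mu> v. f x $ i $ a * (c' x * g x $ b $ j))" for i j a b v
  proof (rule integral_dominated_convergence[where w = "\<lambda>x. B * norm (f x $ i $ a * g x $ b $ j)"])
    show "integrable (scalar_measure \<mu> v) (\<lambda>x. B * norm (f x $ i $ a * g x $ b $ j))"
      by (intro integrable_mult_right integrable_norm integrable_scalar continuous_intros f g)
    show "AE x in scalar_measure \<mu> v. norm (f x $ i $ a * (c N x * g x $ b $ j))
        \<le> B * norm (f x $ i $ a * g x $ b $ j)" for N
    proof (rule AE_I2)
      fix x assume "x \<in> space (scalar_measure \<mu> v)"
      then have "norm (c N x) \<le> B" using bound by simp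
      then have "norm (c N x) * norm (f x $ i $ a * g x $ b $ j) \<le> B * norm (f x $ i $ a * g x $ b $ j)"
        by (rule mult_right_mono) simp
      then show "norm (f x $ i $ a * (c N x * g x $ b $ j)) \<le> B * norm (f x $ i $ a * g x $ b $ j)"
        by (simp add: norm_mult mult_ac)
    qed
    show "AE x in scalar_measure \<mu> v. (\<lambda>N. f x $ i $ a * (c N x * g x $ b $ j))
        \<longlonglongrightarrow> f x $ i $ a * (c' x * g x $ b $ j)"
      by (intro AE_I2 tendsto_intros lim) simp
  qed (intro measurable_scalar_measure continuous_intros f g c)+
  then have e: "(\<lambda>N. entry_integral \<mu> a b (\<lambda>x. f x $ i $ a * (c N x * g x $ b $ j))) \<longlonglongrightarrow>
      entry_integral \<mu> a b (\<lambda>x. f x $ i $ a * (c' x * g x $ b $ j))" for i j a b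
    unfolding entry_integral_def by (intro tendsto_intros) simp_all
  show ?thesis
    unfolding mint_def cscale_nth by (intro tendsto_vec_lambda tendsto_sum e)
qed

end

section \<open>Resolvents of unitary band matrices\<close>

lemma norm_smult: "norm (c *s x) = norm c * norm x" for x :: "complex^'n"
  by (simp add: norm_vec_def norm_mult L2_set_right_distrib)

lemma smult_sum: "c *s (\<Sum>i\<in>I. x i) = (\<Sum>i\<in>I. c *s x i)" for x :: "'a \<Rightarrow> complex^'n"
  by (simp add: vec_eq_iff sum_distrib_left)

text \<open>
  Norms of finite sections replace the \<open>\<ell>\<^sup>2\<close> norm: they are defined for every sequence, so that
  membership in \<^const>\<open>ell2\<close> becomes a bound that is uniform in the length of the section.
\<close>
definition section_norm :: "(nat \<Rightarrow> complex^'n) \<Rightarrow> nat \<Rightarrow> real" where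
  "section_norm u N = L2_set (\<lambda>n. norm (u n)) {..N}"

lemma section_norm_nonneg: "0 \<le> section_norm u N"
  by (simp add: section_norm_def L2_set_nonneg)

lemma norm_le_section_norm: "norm (u n) \<le> section_norm u n"
  unfolding section_norm_def by (rule member_le_L2_set) auto

lemma section_norm_triangle: "section_norm (\<lambda>n. u n + v n) N \<le> section_norm u N + section_norm v N"
proof -
  have "section_norm (\<lambda>n. u n + v n) N \<le> L2_set (\<lambda>n. norm (u n) + norm (v n)) {..N}"
    unfolding section_norm_def by (intro L2_set_mono norm_triangle_ineq) auto
  also have "\<dots> \<le> section_norm u N + section_norm v N"
    unfolding section_norm_def by (rule L2_set_triangle_ineq)
  finally show ?thesis .
qed

lemma section_norm_smult: "section_norm (\<lambda>n. c *s u n) N = norm c * section_norm u N"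
  by (simp add: section_norm_def norm_smult L2_set_right_distrib)

lemma ell2_iff: "u \<in> ell2 \<longleftrightarrow> (\<exists>K. \<forall>N. section_norm u N \<le> K)"
proof
  assume "u \<in> ell2"
  then have s: "summable (\<lambda>n. (norm (u n))\<^sup>2)" by (simp add: ell2_def)
  have "section_norm u N \<le> sqrt (\<Sum>n. (norm (u n))\<^sup>2)" for N
    unfolding section_norm_def L2_set_def by (intro real_sqrt_le_mono sum_le_suminf s) auto
  then show "\<exists>K. \<forall>N. section_norm u N \<le> K" by blast
next
  assume "\<exists>K. \<forall>N. section_norm u N \<le> K"
  then obtain K where K: "\<And>N. section_norm u N \<le> K" by blast
  have "(\<Sum>n\<le>N. (norm (u n))\<^sup>2) \<le> K\<^sup>2" for N
  proof -
    have "(\<Sum>n\<le>N. (norm (u n))\<^sup>2) = (section_norm u N)\<^sup>2"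
      by (simp add: section_norm_def L2_set_def sum_nonneg)
    also have "\<dots> \<le> K\<^sup>2"
      by (intro power_mono K section_norm_nonneg)
    finally show ?thesis .
  qed
  then have "summable (\<lambda>n. (norm (u n))\<^sup>2)"
    by (intro bounded_imp_summable) auto
  then show "u \<in> ell2" by (simp add: ell2_def)
qed

lemma ell2_finite_support: "(\<lambda>n. if n = k then v else 0) \<in> ell2"
  unfolding ell2_def mem_Collect_eq
  by (rule summable_finite[of "{k}"]) auto

text \<open>
  A band matrix whose rows and columns are orthonormal. All rows and columns being finite, the two
  unitarity relations are finite sums, and the operator acts on arbitrary sequences.
\<close>
locale band_unitary =
  fixes C :: "nat \<Rightarrow> nat \<Rightarrow> complex^'n^'n" and w :: nat
  assumes band: "n + w < m \<or> m + w < n \<Longrightarrow> C n m = 0"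
    and columns: "(\<Sum>n\<le>m + w. hadj (C n m) ** C n m') = (if m = m' then mat 1 else 0)"
    and rows: "(\<Sum>m\<le>n + w. C n m ** hadj (C n' m)) = (if n = n' then mat 1 else 0)"
begin

lemma adjoint: "band_unitary (\<lambda>n m. hadj (C m n)) w"
  by standard (use band columns rows in auto)

lemma matrix_op_eq_sum:
  assumes "n + w \<le> N"
  shows "matrix_op C u n = (\<Sum>m\<le>N. C n m *v u m)"
  unfolding matrix_op_def by (rule suminf_finite) (use assms band in auto)

lemma matrix_op_diff: "matrix_op C (\<lambda>m. u m - v m) n = matrix_op C u n - matrix_op C v n"
  by (simp add: matrix_op_eq_sum[OF order_refl] matrix_vector_mult_diff_distrib sum_subtractf)

lemma matrix_op_smult: "matrix_op C (\<lambda>m. c *s u m) n = c *s matrix_op C u n"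
  by (simp add: matrix_op_eq_sum[OF order_refl] smult_sum)

text \<open>
  The first \<open>N\<close> entries of \<open>C u\<close> see only the first \<open>N + w\<close> entries of \<open>u\<close>. The whole image of that
  truncation of \<open>u\<close> has the same norm as the truncation, since the columns of \<open>C\<close> are orthonormal.
\<close>
lemma section_norm_matrix_op: "section_norm (matrix_op C u) N \<le> section_norm u (N + w)"
proof -
  let ?M = "N + w"
  let ?U = "\<lambda>n. \<Sum>m\<le>?M. C n m *v u m"
  have cols: "(\<Sum>n\<le>?M + w. hadj (C n m) ** C n m') = (if m = m' then mat 1 else 0)"
    if "m \<le> ?M" for m m'
    using that columns[of m m'] band
    by (subst sum.mono_neutral_right[of "{..?M + w}" "{..m + w}"]) auto
  have "(\<Sum>n\<le>N. (norm (matrix_op C u n))\<^sup>2) = (\<Sum>n\<le>N. (norm (?U n))\<^sup>2)"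
    by (intro sum.cong refl) (simp add: matrix_op_eq_sum[of _ ?M])
  also have "\<dots> \<le> (\<Sum>n\<le>?M + w. (norm (?U n))\<^sup>2)"
    by (intro sum_mono2) auto
  also have "\<dots> = (\<Sum>n\<le>?M + w. \<Sum>m\<le>?M. \<Sum>m'\<le>?M. u m \<bullet> ((hadj (C n m) ** C n m') *v u m'))"
    unfolding power2_norm_eq_inner inner_sum_left
    unfolding inner_sum_right inner_hadj matrix_vector_mul_assoc ..
  also have "\<dots> = (\<Sum>m\<le>?M. \<Sum>m'\<le>?M. \<Sum>n\<le>?M + w. u m \<bullet> ((hadj (C n m) ** C n m') *v u m'))"
    by (subst sum.swap, intro sum.cong refl sum.swap)
  also have "\<dots> = (\<Sum>m\<le>?M. \<Sum>m'\<le>?M. u m \<bullet> ((\<Sum>n\<le>?M + w. hadj (C n m) ** C n m') *v u m'))"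
    by (simp only: mult_vec_sum_left inner_sum_right)
  also have "\<dots> = (\<Sum>m\<le>?M. \<Sum>m'\<le>?M. if m = m' then u m \<bullet> u m' else 0)"
    by (intro sum.cong refl) (simp add: cols)
  also have "\<dots> = (\<Sum>m\<le>?M. (norm (u m))\<^sup>2)"
    by (intro sum.cong refl) (simp add: power2_norm_eq_inner)
  finally show ?thesis
    by (simp add: section_norm_def L2_set_def)
qed

lemma adjoint_inverse: "matrix_op (\<lambda>n m. hadj (C m n)) (matrix_op C u) = u"
proof
  fix n
  interpret adj: band_unitary "\<lambda>n m. hadj (C m n)" w by (rule adjoint)
  have "matrix_op (\<lambda>n m. hadj (C m n)) (matrix_op C u) n =
      (\<Sum>m\<le>n + w. \<Sum>k\<le>n + w + w. (hadj (C m n) ** C m k) *v u k)"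
    by (simp add: adj.matrix_op_eq_sum[OF order_refl] matrix_op_eq_sum[of _ "n + w + w"]
        mult_vec_sum_right matrix_vector_mul_assoc)
  also have "\<dots> = (\<Sum>k\<le>n + w + w. (\<Sum>m\<le>n + w. hadj (C m n) ** C m k) *v u k)"
    by (subst sum.swap) (simp add: mult_vec_sum_left)
  also have "\<dots> = (\<Sum>k\<le>n + w + w. if n = k then u k else 0)"
    by (intro sum.cong refl) (simp add: columns)
  also have "\<dots> = u n"
    by simp
  finally show "matrix_op (\<lambda>n m. hadj (C m n)) (matrix_op C u) n = u n" .
qed

lemma inverse_adjoint: "matrix_op C (matrix_op (\<lambda>n m. hadj (C m n)) u) = u"
  using band_unitary.adjoint_inverse[OF adjoint] by simp

lemma shifted_op_ell2:
  assumes "u \<in> ell2"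
  shows "shifted_op (matrix_op C) z u \<in> ell2"
proof -
  obtain K where K: "\<And>N. section_norm u N \<le> K"
    using assms by (auto simp: ell2_iff)
  have "section_norm (shifted_op (matrix_op C) z u) N \<le> K + norm z * K" for N
  proof -
    have "shifted_op (matrix_op C) z u = (\<lambda>n. matrix_op C u n + (- z) *s u n)"
      by (simp add: fun_eq_iff shifted_op_def)
    then have "section_norm (shifted_op (matrix_op C) z u) N =
        section_norm (\<lambda>n. matrix_op C u n + (- z) *s u n) N"
      by simp
    also have "\<dots> \<le> section_norm (matrix_op C u) N + norm z * section_norm u N"
      using section_norm_triangle[of "matrix_op C u" "\<lambda>n. (- z) *s u n"] 
      by (simp only: section_norm_smult norm_minus_cancel)
    also have "\<dots> \<le> K + norm z * K"
      by (intro add_mono mult_left_mono order_trans[OF section_norm_matrix_op] K) auto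
    finally show ?thesis .
  qed
  then show ?thesis by (auto simp: ell2_iff)
qed

text \<open>
  A difference \<open>d\<close> of two solutions satisfies \<open>d = z C\<^sup>\<dagger> d\<close>. As \<open>C\<^sup>\<dagger>\<close> is a contraction, iterating this
  bounds every finite section of \<open>d\<close> by a multiple of \<open>|z|\<^sup>k\<close> for all \<open>k\<close>.
\<close>
lemma shifted_op_inj:
  assumes "norm z < 1"
  shows "inj_on (shifted_op (matrix_op C) z) ell2"
proof (rule inj_onI)
  fix u v :: "nat \<Rightarrow> complex^'n"
  assume u: "u \<in> ell2" and v: "v \<in> ell2"
    and eq: "shifted_op (matrix_op C) z u = shifted_op (matrix_op C) z v"
  interpret adj: band_unitary "\<lambda>n m. hadj (C m n)" w by (rule adjoint)
  define d where "d = (\<lambda>n. u n - v n)"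
  have "matrix_op C d = (\<lambda>n. z *s d n)"
  proof
    show "matrix_op C d n = z *s d n" for n
      using fun_cong[OF eq, of n]
      by (simp add: d_def matrix_op_diff shifted_op_def algebra_simps)
  qed
  then have d: "d = (\<lambda>n. z *s matrix_op (\<lambda>n m. hadj (C m n)) d n)"
    using adjoint_inverse[of d] by (simp flip: adj.matrix_op_smult)
  have step: "section_norm d N \<le> norm z * section_norm d (N + w)" for N
  proof -
    have "section_norm d N = norm z * section_norm (matrix_op (\<lambda>n m. hadj (C m n)) d) N"
      by (subst d) (rule section_norm_smult)
    also have "\<dots> \<le> norm z * section_norm d (N + w)"
      by (intro mult_left_mono adj.section_norm_matrix_op) simp
    finally show ?thesis .
  qed
  obtain K L where K: "\<And>N. section_norm u N \<le> K" and L: "\<And>N. section_norm v N \<le> L"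
    using u v by (auto simp: ell2_iff)
  have iter: "section_norm d N \<le> norm z ^ k * (K + L)" for N k
  proof (induction k arbitrary: N)
    case 0
    have "section_norm d N = section_norm (\<lambda>n. u n + (- 1) *s v n) N"
      by (simp add: d_def section_norm_def)
    also have "\<dots> \<le> section_norm u N + norm (- 1 :: complex) * section_norm v N"
      using section_norm_triangle[of u "\<lambda>n. (- 1) *s v n"] by (simp only: section_norm_smult)
    finally show ?case using K[of N] L[of N] by simp
  next
    case (Suc k)
    show ?case
      using order_trans[OF step mult_left_mono[OF Suc.IH norm_ge_zero]] by (simp add: mult_ac)
  qed
  have "section_norm d N \<le> 0" for N
  proof (rule tendsto_lowerbound)
    show "(\<lambda>k. norm z ^ k * (K + L)) \<longlonglongrightarrow> 0"
      using LIMSEQ_realpow_zero[of "norm z"] assms by (simp add: tendsto_mult_left_zero)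
  qed (use iter in auto)
  then have "norm (d n) \<le> 0" for n
    using norm_le_section_norm order_trans by blast
  then show "u = v"
    by (simp add: d_def fun_eq_iff)
qed

text \<open>
  Since \<open>C - z = C (1 - z C\<^sup>\<dagger>)\<close>, the solution of \<open>(C - z) u = v\<close> is \<open>\<Sum>\<^sub>k z\<^sup>k (C\<^sup>\<dagger>)\<^sup>k\<^sup>+\<^sup>1 v\<close>. The series is summed
  entry by entry. Because the rows of \<open>C\<close> are finite, \<open>C\<close> may be applied term by term, and the sum
  lies in \<^const>\<open>ell2\<close> because finite sections pass to the limit.
\<close>
lemma neumann_series:
  assumes z: "norm z < 1" and v: "v \<in> ell2"
  obtains u where "u \<in> ell2" "shifted_op (matrix_op C) z u = v"
    "\<And>j. (\<lambda>k. z ^ k *s (matrix_op (\<lambda>n m. hadj (C m n)) ^^ Suc k) v j) sums u j"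
proof -
  interpret adj: band_unitary "\<lambda>n m. hadj (C m n)" w by (rule adjoint)
  define g where "g k = (matrix_op (\<lambda>n m. hadj (C m n)) ^^ Suc k) v" for k
  obtain K where K: "\<And>N. section_norm v N \<le> K"
    using v by (auto simp: ell2_iff)
  have bound: "section_norm ((matrix_op (\<lambda>n m. hadj (C m n)) ^^ k) v) N \<le> K" for k N
  proof (induction k arbitrary: N)
    case (Suc k)
    then show ?case
      using adj.section_norm_matrix_op order_trans by fastforce
  qed (simp add: K)
  then have gK: "section_norm (g k) N \<le> K" for k N
    unfolding g_def .
  have geom: "summable (\<lambda>k. norm z ^ k * K)"
    by (intro summable_mult2 summable_geometric) (use z in simp)
  have "summable (\<lambda>k. z ^ k *s g k j)" for j
  proof (rule summable_comparison_test'[OF geom])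
    show "norm (z ^ k *s g k j) \<le> norm z ^ k * K" for k
      unfolding norm_smult norm_power
      by (intro mult_left_mono order_trans[OF norm_le_section_norm gK]) simp
  qed
  define u where "u j = (\<Sum>k. z ^ k *s g k j)" for j
  have u: "(\<lambda>k. z ^ k *s g k j) sums u j" for j
    unfolding u_def by (rule summable_sums) fact
  show ?thesis
  proof
    show "u \<in> ell2"
      unfolding ell2_iff
    proof (intro exI allI)
      fix N
      have partial: "section_norm (\<lambda>j. \<Sum>k<M. z ^ k *s g k j) N \<le> (\<Sum>k<M. norm z ^ k * K)" for M
      proof (induction M)
        case 0
        then show ?case by (simp add: section_norm_def L2_set_def)
      next
        case (Suc M)
        have "section_norm (\<lambda>j. z ^ M *s g M j) N \<le> norm z ^ M * K"
          unfolding section_norm_smult norm_power by (intro mult_left_mono gK) simp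
        then show ?case
          using Suc section_norm_triangle[of "\<lambda>j. \<Sum>k<M. z ^ k *s g k j" "\<lambda>j. z ^ M *s g M j" N]
          by simp
      qed
      have "0 \<le> K" using K section_norm_nonneg order_trans by blast
      show "section_norm u N \<le> (\<Sum>k. norm z ^ k * K)"
      proof (rule tendsto_upperbound)
        show "(\<lambda>M. section_norm (\<lambda>j. \<Sum>k<M. z ^ k *s g k j) N) \<longlonglongrightarrow> section_norm u N"
          unfolding section_norm_def L2_set_def
          by (intro tendsto_intros) (use u in \<open>simp add: sums_def\<close>)
        show "\<forall>\<^sub>F M in sequentially. section_norm (\<lambda>j. \<Sum>k<M. z ^ k *s g k j) N \<le> (\<Sum>k. norm z ^ k * K)"
          by (intro always_eventually allI order_trans[OF partial] sum_le_suminf geom)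
            (use \<open>0 \<le> K\<close> in auto)
      qed simp
    qed
    show "shifted_op (matrix_op C) z u = v"
    proof
      fix n
      have "(\<lambda>k. \<Sum>m\<le>n + w. C n m *v (z ^ k *s g k m)) sums (\<Sum>m\<le>n + w. C n m *v u m)"
        by (intro sums_sum bounded_linear.sums[OF matrix_vector_mul_bounded_linear] u)
      then have 1: "(\<lambda>k. z ^ k *s matrix_op C (g k) n) sums matrix_op C u n"
        by (simp add: matrix_op_eq_sum[OF order_refl] smult_sum)
      have "bounded_linear (\<lambda>x. z *s x :: complex^'n)"
      proof -
        have "(\<lambda>x. z *s x :: complex^'n) = (*v) (mat z)"
          by (simp add: fun_eq_iff mat_eq_cscale[of z])
        then show ?thesis by simp
      qed
      from bounded_linear.sums[OF this u[of n]]
      have "(\<lambda>k. z ^ Suc k *s matrix_op C (g (Suc k)) n) sums (z *s u n)"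
        by (simp add: g_def inverse_adjoint mult.commute)
      then have "(\<lambda>k. z ^ k *s matrix_op C (g k) n) sums (z *s u n + v n)"
        by (subst (asm) sums_Suc_iff) (simp add: g_def inverse_adjoint)
      from sums_unique2[OF 1 this] show "shifted_op (matrix_op C) z u n = v n"
        by (simp add: shifted_op_def)
    qed
  qed (use u in \<open>simp add: g_def\<close>)
qed

lemma shifted_op_bij:
  assumes "norm z < 1"
  shows "bij_betw (shifted_op (matrix_op C) z) ell2 ell2"
  unfolding bij_betw_def
proof
  show "shifted_op (matrix_op C) z ` ell2 = ell2"
  proof
    show "ell2 \<subseteq> shifted_op (matrix_op C) z ` ell2"
    proof
      fix v :: "nat \<Rightarrow> complex^'n" assume "v \<in> ell2"
      from neumann_series[OF assms this] obtain u where "u \<in> ell2" "shifted_op (matrix_op C) z u = v" .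
      then show "v \<in> shifted_op (matrix_op C) z ` ell2" by blast
    qed
  qed (auto intro: shifted_op_ell2)
qed (rule shifted_op_inj[OF assms])

lemma resolvent_sums:
  assumes "norm z < 1" and "v \<in> ell2"
  shows "(\<lambda>k. z ^ k *s (matrix_op (\<lambda>n m. hadj (C m n)) ^^ Suc k) v j) sums
    resolvent (matrix_op C) z v j"
proof -
  obtain u where u: "u \<in> ell2" "shifted_op (matrix_op C) z u = v"
    "\<And>j. (\<lambda>k. z ^ k *s (matrix_op (\<lambda>n m. hadj (C m n)) ^^ Suc k) v j) sums u j"
    by (rule neumann_series[OF assms]) (rule that)
  have "resolvent (matrix_op C) z v = u"
    unfolding resolvent_def by (intro inv_into_f_eq shifted_op_inj assms(1) u(1,2))
  with u(3)[of j] show ?thesis by simp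
qed

end

section \<open>Laurent polynomials in the order of the CMV basis\<close>

text \<open>
  The exponents are enumerated as \<open>0, 1, -1, 2, -2, \<dots>\<close>; \<open>window n\<close> holds the first \<open>n + 1\<close> of them and
  \<open>new_exponent n\<close> is the last one.
\<close>
definition window :: "nat \<Rightarrow> int set" where
  "window n = {- int (n div 2)..int (Suc n div 2)}"

definition new_exponent :: "nat \<Rightarrow> int" where
  "new_exponent n = (if even n then - int (n div 2) else int (Suc n div 2))"

lemma finite_window [simp]: "finite (window n)"
  by (simp add: window_def)

lemma window_0 [simp]: "window 0 = {0}" and new_exponent_0 [simp]: "new_exponent 0 = 0"
  by (auto simp: window_def new_exponent_def)

lemma window_Suc: "window (Suc n) = insert (new_exponent (Suc n)) (window n)"
  unfolding window_def new_exponent_def by (auto elim!: evenE oddE)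

lemma new_exponent_notin: "new_exponent (Suc n) \<notin> window n"
  unfolding window_def new_exponent_def by (auto elim!: evenE oddE)

lemma window_mono: "m \<le> n \<Longrightarrow> window m \<subseteq> window n"
  unfolding window_def by (auto simp: div_le_mono intro: order_trans)

lemma window_subset_old: "m < n \<Longrightarrow> window m \<subseteq> window n - {new_exponent n}"
  using window_mono[of m "n - 1"] new_exponent_notin[of "n - 1"] window_Suc[of "n - 1"]
  by (cases n) auto

text \<open>
  One shift of the exponents costs two steps in the enumeration. This is why the CMV matrix has
  band width two.
\<close>
lemma window_shift: "i \<in> window n \<Longrightarrow> \<bar>k\<bar> \<le> 1 \<Longrightarrow> i + k \<in> window (n + 2)"
  by (auto simp: window_def)

definition laurent :: "nat \<Rightarrow> (int \<Rightarrow> complex^'n^'n) \<Rightarrow> complex \<Rightarrow> complex^'n^'n" where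
  "laurent n A x = (\<Sum>i\<in>window n. x powi i *\<^sub>C A i)"

text \<open>
  On the circle the side condition of the general continuity rule for integer powers always holds;
  the specialized rule below avoids it.
\<close>
declare continuous_on_power_int [continuous_intros del]

lemma continuous_on_powi_circle [continuous_intros]:
  "continuous_on (sphere 0 1) (\<lambda>x::complex. x powi i)"
  by (rule continuous_on_power_int) auto

lemma continuous_on_laurent [continuous_intros]: "continuous_on (sphere 0 1) (laurent n A)"
  unfolding laurent_def by (intro continuous_intros)

lemma laurent_shift:
  assumes "\<bar>k\<bar> \<le> 1"
  shows "\<exists>B. \<forall>x. x \<noteq> 0 \<longrightarrow> x powi k *\<^sub>C laurent n A x = laurent (n + 2) B x"
proof (intro exI allI impI)
  fix x :: complex assume x: "x \<noteq> 0"
  have "x powi k *\<^sub>C laurent n A x = (\<Sum>i\<in>window n. x powi (i + k) *\<^sub>C A i)"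
    by (simp add: laurent_def cscale_sum power_int_add x mult.commute)
  also have "\<dots> = (\<Sum>i\<in>(\<lambda>i. i + k) ` window n. x powi i *\<^sub>C A (i - k))"
    by (subst sum.reindex) (auto simp: inj_on_def)
  also have "\<dots> = (\<Sum>i\<in>(\<lambda>i. i + k) ` window n.
      x powi i *\<^sub>C (if i - k \<in> window n then A (i - k) else 0))"
    by (intro sum.cong) auto
  also have "\<dots> = laurent (n + 2) (\<lambda>i. if i - k \<in> window n then A (i - k) else 0) x"
    unfolding laurent_def
  proof (rule sum.mono_neutral_left)
    show "(\<lambda>i. i + k) ` window n \<subseteq> window (n + 2)"
      using window_shift[OF _ assms] by blast
    show "\<forall>i\<in>window (n + 2) - (\<lambda>i. i + k) ` window n.
        x powi i *\<^sub>C (if i - k \<in> window n then A (i - k) else 0) = 0"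
      by (auto simp: image_iff) (metis diff_add_cancel)
  qed simp
  finally show "x powi k *\<^sub>C laurent n A x =
      laurent (n + 2) (\<lambda>i. if i - k \<in> window n then A (i - k) else 0) x" .
qed

text \<open>
  The divided difference of a monomial is a Laurent polynomial whose exponents lie between \<open>0\<close> and
  \<open>i\<close>; at most one of the two intervals is non-empty.
\<close>
lemma divided_difference_powi:
  fixes z :: complex
  assumes z: "z \<noteq> 0"
  shows "\<exists>c. \<forall>x. x \<noteq> 0 \<longrightarrow> x powi i - z powi i = (x - z) * (\<Sum>s\<in>{0..<i} \<union> {i..<0}. c s * x powi s)"
proof (cases "0 \<le> i")
  case True
  have "x powi i - z powi i = (x - z) * (\<Sum>s\<in>{0..<i}. z powi (i - 1 - s) * x powi s)"
    if "x \<noteq> 0" for x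
    using True
  proof (induction i rule: int_ge_induct)
    case (step i)
    have "{0..<i + 1} = insert i {0..<i}" using step by auto
    then have "(\<Sum>s\<in>{0..<i + 1}. z powi (i + 1 - 1 - s) * x powi s) =
        x powi i + (\<Sum>s\<in>{0..<i}. z powi (i - s) * x powi s)"
      by simp
    also have "(\<Sum>s\<in>{0..<i}. z powi (i - s) * x powi s) =
        z * (\<Sum>s\<in>{0..<i}. z powi (i - 1 - s) * x powi s)"
      unfolding sum_distrib_left using z
      by (intro sum.cong refl) (simp add: power_int_diff)
    finally have "(x - z) * (\<Sum>s\<in>{0..<i + 1}. z powi (i + 1 - 1 - s) * x powi s) =
        (x - z) * x powi i + z * ((x - z) * (\<Sum>s\<in>{0..<i}. z powi (i - 1 - s) * x powi s))"
      by (simp only: algebra_simps)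
    also have "\<dots> = (x - z) * x powi i + z * (x powi i - z powi i)"
      by (simp only: step)
    also have "\<dots> = x powi (i + 1) - z powi (i + 1)"
      using z that by (simp add: power_int_add algebra_simps)
    finally show ?case ..
  qed simp
  moreover have "{0..<i} \<union> {i..<0} = {0..<i}" using True by auto
  ultimately show ?thesis
    by (intro exI[of _ "\<lambda>s. z powi (i - 1 - s)"]) auto
next
  case False
  then have "i \<le> 0" by simp
  then have "x powi i - z powi i = (x - z) * (\<Sum>s\<in>{i..<0}. - (z powi (i - 1 - s)) * x powi s)"
    if "x \<noteq> 0" for x
  proof (induction i rule: int_le_induct)
    case (step i)
    have "{i - 1..<0} = insert (i - 1) {i..<0}" using step by auto
    then have "(\<Sum>s\<in>{i - 1..<0}. - (z powi (i - 1 - 1 - s)) * x powi s) =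
        - (x powi (i - 1) / z) + (\<Sum>s\<in>{i..<0}. - (z powi (i - 2 - s)) * x powi s)"
      using z by (simp add: power_int_minus_left field_simps)
    also have "(\<Sum>s\<in>{i..<0}. - (z powi (i - 2 - s)) * x powi s) =
        (\<Sum>s\<in>{i..<0}. - (z powi (i - 1 - s)) * x powi s) / z"
      unfolding sum_divide_distrib using z
      by (intro sum.cong refl) (simp add: power_int_diff power2_eq_square)
    finally have "(x - z) * (\<Sum>s\<in>{i - 1..<0}. - (z powi (i - 1 - 1 - s)) * x powi s) =
        - ((x - z) * x powi (i - 1) / z) +
        ((x - z) * (\<Sum>s\<in>{i..<0}. - (z powi (i - 1 - s)) * x powi s)) / z"
      by (simp only: distrib_left mult_minus_right times_divide_eq_right)
    also have "\<dots> = - ((x - z) * x powi (i - 1) / z) + (x powi i - z powi i) / z"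
      by (simp only: step)
    also have "\<dots> = x powi (i - 1) - z powi (i - 1)"
      using z that by (simp add: power_int_diff field_simps)
    finally show ?case ..
  qed simp
  moreover have "{0..<i} \<union> {i..<0} = {i..<0}" using False by auto
  ultimately show ?thesis
    by (intro exI[of _ "\<lambda>s. - (z powi (i - 1 - s))"]) auto
qed

lemma cnj_circle: "x \<in> sphere 0 1 \<Longrightarrow> cnj x = inverse x"
  using complex_norm_square[of x] by (metis dist_0_norm inverse_unique mem_sphere of_real_1 one_power2)

lemma cnj_powi_circle: "x \<in> sphere 0 1 \<Longrightarrow> cnj (x powi i) = x powi (- i)"
  by (simp add: cnj_circle power_int_minus power_int_inverse flip: power_int_inverse)

section \<open>Evaluation of Cauchy integrals by orthogonality\<close>

context hermitian_measure
begin

text \<open>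
  The evaluation principle behind the whole formula. Against \<open>(x - z)\<^sup>-\<^sup>1\<close> the factor \<open>x\<^sup>i\<close> may be
  replaced by its value \<open>z\<^sup>i\<close>, because the difference is a divided difference, hence a Laurent
  polynomial with exponents between \<open>0\<close> and \<open>i\<close>, and orthogonality removes all of these.
\<close>
lemma evaluate_cauchy:
  assumes f: "continuous_on (sphere 0 1) f" and g: "continuous_on (sphere 0 1) g"
    and z: "z \<in> ball 0 1 - {0}"
    and orth: "\<And>s. s \<in> {0..<i} \<union> {i..<0} \<Longrightarrow> mint \<mu> f (\<lambda>x. x powi s *\<^sub>C g x) = 0"
  shows "mint \<mu> f (\<lambda>x. (x powi i * inverse (x - z)) *\<^sub>C g x) =
    z powi i *\<^sub>C mint \<mu> f (\<lambda>x. inverse (x - z) *\<^sub>C g x)"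
proof -
  obtain c where c: "x \<noteq> 0 \<Longrightarrow> x powi i - z powi i =
      (x - z) * (\<Sum>s\<in>{0..<i} \<union> {i..<0}. c s * x powi s)" for x
    using divided_difference_powi[of z i] z by auto
  have cont: "continuous_on (sphere 0 1) (\<lambda>x. inverse (x - z))"
    using z by (intro continuous_intros) auto
  have "mint \<mu> f (\<lambda>x. (x powi i * inverse (x - z)) *\<^sub>C g x) =
      mint \<mu> f (\<lambda>x. (\<Sum>s\<in>{0..<i} \<union> {i..<0}. c s *\<^sub>C (x powi s *\<^sub>C g x)) +
        z powi i *\<^sub>C (inverse (x - z) *\<^sub>C g x))"
  proof (rule mint_cong)
    fix x :: complex assume "x \<in> sphere 0 1"
    then have "x \<noteq> 0" "x \<noteq> z" using z by auto
    have "x powi i = (x - z) * (\<Sum>s\<in>{0..<i} \<union> {i..<0}. c s * x powi s) + z powi i"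
      using c[OF \<open>x \<noteq> 0\<close>] by (simp add: algebra_simps)
    then have "x powi i * inverse (x - z) =
        (\<Sum>s\<in>{0..<i} \<union> {i..<0}. c s * x powi s) + z powi i * inverse (x - z)"
      using \<open>x \<noteq> z\<close> by (simp add: field_simps)
    then show "(x powi i * inverse (x - z)) *\<^sub>C g x =
        (\<Sum>s\<in>{0..<i} \<union> {i..<0}. c s *\<^sub>C (x powi s *\<^sub>C g x)) + z powi i *\<^sub>C (inverse (x - z) *\<^sub>C g x)"
      by (simp only: cscale_linear sum_cscale cscale_simps)
  qed simp
  also have "\<dots> = z powi i *\<^sub>C mint \<mu> f (\<lambda>x. inverse (x - z) *\<^sub>C g x)"
  proof (subst mint_add_right)
    have "mint \<mu> f (\<lambda>x. \<Sum>s\<in>{0..<i} \<union> {i..<0}. c s *\<^sub>C (x powi s *\<^sub>C g x)) = 0"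
      by (subst mint_sum_right)
        (auto intro!: continuous_intros f g simp: mint_cscale_right orth simp del: cscale_simps(4))
    then show "mint \<mu> f (\<lambda>x. \<Sum>s\<in>{0..<i} \<union> {i..<0}. c s *\<^sub>C (x powi s *\<^sub>C g x)) +
        mint \<mu> f (\<lambda>x. z powi i *\<^sub>C (inverse (x - z) *\<^sub>C g x)) =
        z powi i *\<^sub>C mint \<mu> f (\<lambda>x. inverse (x - z) *\<^sub>C g x)"
      by (simp add: mint_cscale_right del: cscale_simps)
  qed (intro continuous_intros f g cont)+
  finally show ?thesis .
qed

lemma hadj_ipR: "hadj (ipR \<mu> f g) = ipR \<mu> g f"
  by (simp add: ipR_def hadj_mint)

lemma ipR_powi_move: "ipR \<mu> (\<lambda>x. x powi i *\<^sub>C f x) g = ipR \<mu> f (\<lambda>x. x powi (- i) *\<^sub>C g x)"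
proof -
  have "ipR \<mu> (\<lambda>x. x powi i *\<^sub>C f x) g = mint \<mu> (\<lambda>x. x powi (- i) *\<^sub>C hadj (f x)) g"
    unfolding ipR_def by (rule mint_cong) (simp_all add: cnj_powi_circle del: complex_cnj_power_int)
  then show ?thesis
    by (simp add: mint_scalar_move ipR_def)
qed

lemma ipR_unimodular_cancel:
  "ipR \<mu> f (\<lambda>x. x powi (- i) *\<^sub>C (x powi i *\<^sub>C g x)) = ipR \<mu> f g"
  unfolding ipR_def
proof (rule mint_cong)
  show "x powi (- i) *\<^sub>C (x powi i *\<^sub>C g x) = g x" if "x \<in> sphere 0 1" for x
  proof -
    have "x \<noteq> 0" using that by auto
    then show ?thesis by (simp add: power_int_minus)
  qed
qed simp

end

text \<open>
  When the evaluation principle is applied to all monomials of \<open>X\<^sub>j(1 / cnj x)\<^sup>\<dagger>\<close>, respectively of \<open>X\<^sub>k\<close>,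
  the exponents that occur lie in the window to which the other basis function is orthogonal. On
  the diagonal this depends on the parity: an even index has a new negative exponent \<open>-m\<close>, and the
  divided differences stop at \<open>-m + 1\<close>; an odd index has a new positive exponent \<open>m\<close>, and they stop
  at \<open>m - 1\<close>.
\<close>
lemma exponents_upper:
  assumes "i \<in> window j" "s \<in> {0..<- i} \<union> {- i..<0}" "j < k \<or> j = k \<and> even j"
  shows "- s \<in> window k - {new_exponent k}"
proof -
  have "- s \<in> window j" "even j \<Longrightarrow> - s \<noteq> new_exponent j"
    using assms by (auto simp: window_def new_exponent_def)
  then show ?thesis
    using assms(3) window_subset_old[of j k] by auto
qed

lemma exponents_lower:
  assumes "i \<in> window k" "s \<in> {0..<i} \<union> {i..<0}" "k < j \<or> j = k \<and> odd j"
  shows "s \<in> window j - {new_exponent j}"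
proof -
  have "s \<in> window k" "odd k \<Longrightarrow> s \<noteq> new_exponent k"
    using assms by (auto simp: window_def new_exponent_def)
  then show ?thesis
    using assms(3) window_subset_old[of k j] by auto
qed

section \<open>Orthonormal bases of Laurent polynomials and their multiplication matrices\<close>

text \<open>
  The data of a Gram--Schmidt process along the enumeration of the exponents. Both the basis
  property and orthonormality follow from triangularity with invertible leading coefficients.
\<close>
locale laurent_basis = hermitian_measure +
  fixes X :: "nat \<Rightarrow> complex \<Rightarrow> complex^'n^'n" and A :: "nat \<Rightarrow> int \<Rightarrow> complex^'n^'n"
  assumes expansion: "x \<noteq> 0 \<Longrightarrow> X n x = laurent n (A n) x"
    and leading: "invertible (A n (new_exponent n))"
    and orthogonal: "i \<in> window n - {new_exponent n} \<Longrightarrow>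
      mint \<mu> (\<lambda>x. mat 1) (\<lambda>x. x powi (- i) *\<^sub>C X n x) = 0"
    and normalized: "ipR \<mu> (X n) (X n) = mat 1"
begin

lemma continuous_on_basis [continuous_intros]: "continuous_on (sphere 0 1) (X n)"
proof (rule continuous_on_cong[THEN iffD1, OF refl _ continuous_on_laurent])
  show "laurent n (A n) x = X n x" if "x \<in> sphere 0 1" for x
    using that by (subst expansion) auto
qed

lemma orthogonal_adjoint:
  assumes "i \<in> window n - {new_exponent n}"
  shows "mint \<mu> (\<lambda>x. hadj (X n x)) (\<lambda>x. x powi i *\<^sub>C mat 1) = 0"
proof -
  have "mint \<mu> (\<lambda>x. hadj (X n x)) (\<lambda>x. x powi i *\<^sub>C mat 1) =
      mint \<mu> (\<lambda>x. hadj (x powi (- i) *\<^sub>C X n x)) (\<lambda>x. hadj (mat 1))"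
    by (subst mint_scalar_move[symmetric], rule mint_cong)
      (simp_all add: cnj_powi_circle del: complex_cnj_power_int)
  also have "\<dots> = hadj 0"
    unfolding hadj_mint[symmetric] orthogonal[OF assms] ..
  finally show ?thesis by simp
qed

lemma ipR_laurent_left:
  assumes "continuous_on (sphere 0 1) f"
    and "\<And>x. x \<noteq> 0 \<Longrightarrow> g x = laurent n B x"
  shows "ipR \<mu> g f = (\<Sum>i\<in>window n. hadj (B i) ** mint \<mu> (\<lambda>x. mat 1) (\<lambda>x. x powi (- i) *\<^sub>C f x))"
proof -
  have "ipR \<mu> g f = mint \<mu> (\<lambda>x. \<Sum>i\<in>window n. x powi (- i) *\<^sub>C (hadj (B i) ** mat 1)) f"
    unfolding ipR_def
  proof (rule mint_cong)
    fix x :: complex assume x: "x \<in> sphere 0 1"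
    then have "x \<noteq> 0" by auto
    then show "hadj (g x) = (\<Sum>i\<in>window n. x powi (- i) *\<^sub>C (hadj (B i) ** mat 1))"
      using x by (simp add: assms laurent_def hadj_sum cnj_powi_circle del: complex_cnj_power_int)
  qed simp
  also have "\<dots> = (\<Sum>i\<in>window n. mint \<mu> (\<lambda>x. x powi (- i) *\<^sub>C (hadj (B i) ** mat 1)) f)"
    by (intro mint_sum_left continuous_intros assms)
  also have "\<dots> = (\<Sum>i\<in>window n. hadj (B i) ** mint \<mu> (\<lambda>x. mat 1) (\<lambda>x. x powi (- i) *\<^sub>C f x))"
    by (subst mint_scalar_move, subst mint_mult_left) (intro continuous_intros assms refl)+
  finally show ?thesis .
qed

lemma orthonormal: "ipR \<mu> (X m) (X n) = (if m = n then mat 1 else 0)"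
proof -
  have less: "ipR \<mu> (X m) (X n) = 0" if "m < n" for m n
  proof -
    have "mint \<mu> (\<lambda>x. mat 1) (\<lambda>x. x powi (- i) *\<^sub>C X n x) = 0" if "i \<in> window m" for i
      using orthogonal[of i n] window_subset_old[OF \<open>m < n\<close>] that by auto
    then show ?thesis
      by (subst ipR_laurent_left[OF continuous_on_basis expansion]) simp_all
  qed
  show ?thesis
    using less[of m n] less[of n m] hadj_ipR[of "X n" "X m"] normalized
    by (cases m n rule: linorder_cases) auto
qed

lemma laurent_in_span:
  "\<exists>D. \<forall>x. x \<noteq> 0 \<longrightarrow> laurent n B x = (\<Sum>m\<le>n. X m x ** D m)"
proof (induction n arbitrary: B)
  case 0
  obtain A' where A': "A 0 0 ** A' = mat 1"
    using leading[of 0] by (auto simp: invertible_def)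
  have "laurent 0 B x = (\<Sum>m\<le>0. X m x ** (A' ** B 0))" if "x \<noteq> 0" for x
    using that by (simp add: expansion laurent_def matrix_mul_assoc A')
  then show ?case by (intro exI[of _ "\<lambda>m. A' ** B 0"]) simp
next
  case (Suc n)
  let ?e = "new_exponent (Suc n)"
  obtain A' where A': "A (Suc n) ?e ** A' = mat 1"
    using leading[of "Suc n"] by (auto simp: invertible_def)
  \<comment> \<open>With this factor the new basis function takes over the coefficient of the new exponent.\<close>
  define T where "T = A' ** B ?e"
  obtain D where D: "x \<noteq> 0 \<Longrightarrow> laurent n (\<lambda>i. B i - A (Suc n) i ** T) x = (\<Sum>m\<le>n. X m x ** D m)" for x
    using Suc.IH by blast
  have "laurent (Suc n) B x = (\<Sum>m\<le>Suc n. X m x ** (D(Suc n := T)) m)" if x: "x \<noteq> 0" for x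
  proof -
    have "A (Suc n) ?e ** T = B ?e"
      by (simp add: T_def matrix_mul_assoc A')
    then have "X (Suc n) x ** T =
        x powi ?e *\<^sub>C B ?e + (\<Sum>i\<in>window n. x powi i *\<^sub>C (A (Suc n) i ** T))"
      using x by (simp add: expansion laurent_def window_Suc new_exponent_notin
          matrix_mult_sum_left matrix_mult_add_left)
    then have "laurent (Suc n) B x = laurent n (\<lambda>i. B i - A (Suc n) i ** T) x + X (Suc n) x ** T"
      by (simp add: laurent_def window_Suc new_exponent_notin cscale_linear sum_subtractf)
    then show ?thesis by (simp add: D x)
  qed
  then show ?case by blast
qed

lemma fourier_expansion:
  assumes f: "\<And>x. x \<noteq> 0 \<Longrightarrow> f x = laurent n B x"
  shows "x \<noteq> 0 \<Longrightarrow> f x = (\<Sum>m\<le>n. X m x ** ipR \<mu> (X m) f)"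
    and "n < k \<Longrightarrow> ipR \<mu> (X k) f = 0"
proof -
  obtain D where D: "x \<noteq> 0 \<Longrightarrow> f x = (\<Sum>m\<le>n. X m x ** D m)" for x
    using laurent_in_span f by metis
  have coeff: "ipR \<mu> (X k) f = (if k \<le> n then D k else 0)" for k
  proof -
    have "ipR \<mu> (X k) f = mint \<mu> (\<lambda>x. hadj (X k x)) (\<lambda>x. \<Sum>m\<le>n. X m x ** D m)"
      unfolding ipR_def
    proof (rule mint_cong)
      show "f x = (\<Sum>m\<le>n. X m x ** D m)" if "x \<in> sphere 0 1" for x
        by (rule D) (use that in auto)
    qed simp
    also have "\<dots> = (\<Sum>m\<le>n. ipR \<mu> (X k) (X m) ** D m)"
      unfolding ipR_def
      by (subst mint_sum_right) (auto intro!: continuous_intros sum.cong mint_mult_right)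
    also have "\<dots> = (\<Sum>m\<le>n. if k = m then D m else 0)"
      by (intro sum.cong) (simp_all add: orthonormal)
    finally show ?thesis by simp
  qed
  show "x \<noteq> 0 \<Longrightarrow> f x = (\<Sum>m\<le>n. X m x ** ipR \<mu> (X m) f)"
    by (simp add: coeff D)
  show "n < k \<Longrightarrow> ipR \<mu> (X k) f = 0"
    by (simp add: coeff)
qed

text \<open>
  With a Laurent polynomial on one side the Parseval identity is a finite sum, and the other
  function can be any continuous one.
\<close>
lemma parseval:
  assumes f: "\<And>x. x \<noteq> 0 \<Longrightarrow> f x = laurent n B x" and g: "continuous_on (sphere 0 1) g"
  shows "(\<Sum>m\<le>n. hadj (ipR \<mu> (X m) f) ** ipR \<mu> (X m) g) = ipR \<mu> f g"
proof -
  have "ipR \<mu> f g = mint \<mu> (\<lambda>x. \<Sum>m\<le>n. hadj (ipR \<mu> (X m) f) ** hadj (X m x)) g"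
    unfolding ipR_def[of \<mu> f g]
  proof (rule mint_cong)
    fix x :: complex assume "x \<in> sphere 0 1"
    then have "x \<noteq> 0" by auto
    from fourier_expansion(1)[OF f this]
    show "hadj (f x) = (\<Sum>m\<le>n. hadj (ipR \<mu> (X m) f) ** hadj (X m x))"
      by (metis (mono_tags, lifting) hadj_mult hadj_sum sum.cong)
  qed simp
  also have "\<dots> = (\<Sum>m\<le>n. hadj (ipR \<mu> (X m) f) ** ipR \<mu> (X m) g)"
    unfolding ipR_def[of \<mu> _ g]
    by (subst mint_sum_left) (auto intro!: continuous_intros g sum.cong mint_mult_left)
  finally show ?thesis ..
qed

text \<open>
  The matrix of multiplication by \<open>x\<^sup>i\<close>. The CMV matrix is the case \<open>i = 1\<close>, its adjoint is
  \<open>i = -1\<close>.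
\<close>
definition mult_matrix :: "int \<Rightarrow> nat \<Rightarrow> nat \<Rightarrow> complex^'n^'n" where
  "mult_matrix i j k = ipR \<mu> (X j) (\<lambda>x. x powi i *\<^sub>C X k x)"

lemma hadj_mult_matrix: "hadj (mult_matrix i j k) = mult_matrix (- i) k j"
  by (simp add: mult_matrix_def hadj_ipR ipR_powi_move)

lemma shift_laurent:
  assumes "\<bar>i\<bar> \<le> 1"
  obtains B where "\<And>x. x \<noteq> 0 \<Longrightarrow> x powi i *\<^sub>C X k x = laurent (k + 2) B x"
  using laurent_shift[OF assms, of k "A k"] expansion by metis

lemma mult_matrix_parseval:
  assumes "\<bar>i\<bar> \<le> 1" and "continuous_on (sphere 0 1) g"
  shows "(\<Sum>m\<le>j + 2. hadj (mult_matrix i m j) ** ipR \<mu> (X m) g) = ipR \<mu> (X j) (\<lambda>x. x powi (- i) *\<^sub>C g x)"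
proof -
  obtain B where "\<And>x. x \<noteq> 0 \<Longrightarrow> x powi i *\<^sub>C X j x = laurent (j + 2) B x"
    using shift_laurent[OF assms(1), of j] by blast
  from parseval[OF this assms(2)] show ?thesis
    by (simp add: mult_matrix_def ipR_powi_move)
qed

lemma mult_matrix_band: "\<bar>i\<bar> \<le> 1 \<Longrightarrow> k + 2 < j \<Longrightarrow> mult_matrix i j k = 0"
  unfolding mult_matrix_def by (rule shift_laurent[of i k], assumption, rule fourier_expansion(2))

lemma mult_matrix_isometry:
  assumes "\<bar>i\<bar> \<le> 1"
  shows "(\<Sum>m\<le>j + 2. hadj (mult_matrix i m j) ** mult_matrix i m k) = (if j = k then mat 1 else 0)"
  using mult_matrix_parseval[OF assms, of "\<lambda>x. x powi i *\<^sub>C X k x" j]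
  unfolding ipR_unimodular_cancel orthonormal
  by (simp add: mult_matrix_def continuous_intros)

sublocale cmv: band_unitary "mult_matrix 1" 2
proof
  show "mult_matrix 1 n m = 0" if "n + 2 < m \<or> m + 2 < n" for n m
    using that mult_matrix_band[of 1 m n] mult_matrix_band[of "- 1" n m] hadj_mult_matrix[of "-1" m n]
    by auto
  show "(\<Sum>n\<le>m + 2. hadj (mult_matrix 1 n m) ** mult_matrix 1 n m') = (if m = m' then mat 1 else 0)" for m m'
    by (rule mult_matrix_isometry) simp
  show "(\<Sum>m\<le>n + 2. mult_matrix 1 n m ** hadj (mult_matrix 1 n' m)) = (if n = n' then mat 1 else 0)" for n n'
    using mult_matrix_isometry[of "- 1" n n'] by (simp add: hadj_mult_matrix)
qed

text \<open>
  Powers of the adjoint matrix are again multiplications by powers of \<open>x\<close>: each step is one Parseval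
  sum.
\<close>
lemma adjoint_power:
  "(matrix_op (\<lambda>n m. hadj (mult_matrix 1 m n)) ^^ N) (\<lambda>n. if n = k then a else 0) j =
    ipR \<mu> (X j) (\<lambda>x. x powi (- int N) *\<^sub>C X k x) *v a"
proof (induction N arbitrary: j)
  case 0
  show ?case by (simp add: orthonormal)
next
  case (Suc N)
  interpret adj: band_unitary "\<lambda>n m. hadj (mult_matrix 1 m n)" 2 by (rule cmv.adjoint)
  let ?g = "\<lambda>x. x powi (- int N) *\<^sub>C X k x"
  have "(matrix_op (\<lambda>n m. hadj (mult_matrix 1 m n)) ^^ Suc N) (\<lambda>n. if n = k then a else 0) j =
      (\<Sum>m\<le>j + 2. (hadj (mult_matrix 1 m j) ** ipR \<mu> (X m) ?g) *v a)"
    by (simp add: adj.matrix_op_eq_sum[OF order_refl] Suc matrix_vector_mul_assoc del: sum.atMost_Suc)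
  also have "\<dots> = ipR \<mu> (X j) (\<lambda>x. x powi (- 1) *\<^sub>C ?g x) *v a"
    unfolding mult_vec_sum_left[symmetric]
    by (subst mult_matrix_parseval) (auto intro!: continuous_intros)
  also have "ipR \<mu> (X j) (\<lambda>x. x powi (- 1) *\<^sub>C ?g x) = ipR \<mu> (X j) (\<lambda>x. x powi (- int (Suc N)) *\<^sub>C X k x)"
    unfolding ipR_def
  proof (rule mint_cong)
    fix x :: complex assume "x \<in> sphere 0 1"
    then have "x \<noteq> 0" by auto
    then show "x powi (- 1) *\<^sub>C ?g x = x powi (- int (Suc N)) *\<^sub>C X k x"
      by (simp add: power_int_diff power_int_minus divide_inverse)
  qed simp
  finally show ?case .
qed

section \<open>The resolvent as a matrix of Cauchy integrals\<close>

text \<open>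
  The Green's function: multiplication by \<open>(x - z)\<^sup>-\<^sup>1\<close> on the circle, written in the basis \<open>X\<close>.
\<close>
definition green :: "complex \<Rightarrow> nat \<Rightarrow> nat \<Rightarrow> complex^'n^'n" where
  "green z j k = ipR \<mu> (X j) (\<lambda>x. inverse (x - z) *\<^sub>C X k x)"

text \<open>
  This is the geometric series \<open>(x - z)\<^sup>-\<^sup>1 = \<Sum>\<^sub>N z\<^sup>N x\<^sup>-\<^sup>N\<^sup>-\<^sup>1\<close>, integrated term by term by dominated
  convergence.
\<close>
lemma green_sums:
  assumes z: "norm z < 1"
  shows "(\<lambda>N. z ^ N *\<^sub>C ipR \<mu> (X j) (\<lambda>x. x powi (- int (Suc N)) *\<^sub>C X k x)) sums green z j k"
proof -
  define c where "c N x = (\<Sum>n<N. z ^ n * x powi (- int (Suc n)))" for N and x :: complex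
  have partial: "(\<Sum>n<N. z ^ n *\<^sub>C ipR \<mu> (X j) (\<lambda>x. x powi (- int (Suc n)) *\<^sub>C X k x)) =
      mint \<mu> (\<lambda>x. hadj (X j x)) (\<lambda>x. c N x *\<^sub>C X k x)" for N
    unfolding c_def sum_cscale ipR_def
    by (subst mint_sum_right) (auto intro!: continuous_intros simp flip: mint_cscale_right)
  have summand: "z ^ n * x powi (- int (Suc n)) = inverse x * (z * inverse x) ^ n" for n and x :: complex
    by (simp add: power_int_def power_mult_distrib nat_add_distrib mult_ac)
  have "(\<lambda>N. mint \<mu> (\<lambda>x. hadj (X j x)) (\<lambda>x. c N x *\<^sub>C X k x)) \<longlonglongrightarrow>
      mint \<mu> (\<lambda>x. hadj (X j x)) (\<lambda>x. inverse (x - z) *\<^sub>C X k x)"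
  proof (rule mint_tendsto)
    show "continuous_on (sphere 0 1) (\<lambda>x. inverse (x - z))"
      using z by (intro continuous_intros) auto
    show "continuous_on (sphere 0 1) (c N)" for N
      unfolding c_def by (intro continuous_intros)
    show "(\<lambda>N. c N x) \<longlonglongrightarrow> inverse (x - z)" if "x \<in> sphere 0 1" for x
    proof -
      have "x \<noteq> 0" "norm (z * inverse x) < 1"
        using that z by (auto simp: norm_mult norm_inverse)
      then have "(\<lambda>n. inverse x * (z * inverse x) ^ n) sums (inverse x * (1 / (1 - z * inverse x)))"
        by (intro sums_mult geometric_sums)
      also have "inverse x * (1 / (1 - z * inverse x)) = inverse (x - z)"
        using \<open>x \<noteq> 0\<close> by (auto simp: divide_simps)
      finally show ?thesis
        unfolding sums_def c_def summand .
    qed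
    show "norm (c N x) \<le> 1 / (1 - norm z)" if "x \<in> sphere 0 1" for N x
    proof -
      have "norm (c N x) \<le> (\<Sum>n<N. norm z ^ n)"
        unfolding c_def using that
        by (intro sum_norm_le) (simp add: norm_mult norm_power norm_power_int)
      also have "\<dots> \<le> (\<Sum>n. norm z ^ n)"
        by (intro sum_le_suminf summable_geometric) (use z in auto)
      also have "\<dots> = 1 / (1 - norm z)"
        by (rule suminf_geometric) (use z in simp)
      finally show ?thesis .
    qed
  qed (intro continuous_intros)+
  then show ?thesis
    unfolding sums_def partial unfolding green_def ipR_def .
qed

lemma op_block_resolvent:
  assumes z: "norm z < 1"
  shows "op_block (resolvent (matrix_op (mult_matrix 1)) z) j k = green z j k"
proof -
  have "resolvent (matrix_op (mult_matrix 1)) z (\<lambda>n. if n = k then a else 0) j = green z j k *v a" for a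
  proof (rule sums_unique2)
    show "(\<lambda>N. (z ^ N *\<^sub>C ipR \<mu> (X j) (\<lambda>x. x powi (- int (Suc N)) *\<^sub>C X k x)) *v a) sums
        resolvent (matrix_op (mult_matrix 1)) z (\<lambda>n. if n = k then a else 0) j"
      using cmv.resolvent_sums[OF z ell2_finite_support, of k a j] unfolding adjoint_power by simp
    have "(\<lambda>N. (B N :: complex^'n^'n) *v a) sums (G *v a)" if "B sums G" for B G
    proof -
      have "(\<lambda>N. B N $ i $ l) sums (G $ i $ l)" for i l
        using bounded_linear.sums[OF bounded_linear_vec_nth bounded_linear.sums[OF bounded_linear_vec_nth that]] .
      then have "(\<lambda>N. (B N *v a) $ i) sums ((G *v a) $ i)" for i
        unfolding matrix_vector_mult_def vec_lambda_beta by (intro sums_sum sums_mult2)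
      then show ?thesis
        unfolding sums_def by (intro vec_tendstoI) simp
    qed
    from this[OF green_sums[OF z]]
    show "(\<lambda>N. (z ^ N *\<^sub>C ipR \<mu> (X j) (\<lambda>x. x powi (- int (Suc N)) *\<^sub>C X k x)) *v a) sums (green z j k *v a)" .
  qed
  then show ?thesis
    by (simp add: op_block_def)
qed

text \<open>
  When \<open>X\<^sub>k\<close> comes later than \<open>X\<^sub>j\<close> in the enumeration, it is orthogonal to all divided differences of
  \<open>X\<^sub>j\<^sup>\<dagger>\<close>. Hence \<open>X\<^sub>j\<^sup>\<dagger>\<close>, continued off the circle as \<open>X\<^sub>j(1 / cnj z)\<^sup>\<dagger>\<close>, can be evaluated at \<open>z\<close> and taken
  out of the integral. In \<open>green_lower\<close> the roles are exchanged.
\<close>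
lemma green_upper:
  assumes z: "z \<in> ball 0 1 - {0}" and jk: "j < k \<or> j = k \<and> even j"
  shows "green z j k = hadj (X j (1 / cnj z)) ** mint \<mu> (\<lambda>x. mat 1) (\<lambda>x. inverse (x - z) *\<^sub>C X k x)"
proof -
  let ?I = "mint \<mu> (\<lambda>x. mat 1) (\<lambda>x. inverse (x - z) *\<^sub>C X k x)"
  have cont: "continuous_on (sphere 0 1) (\<lambda>x. inverse (x - z))"
    using z by (intro continuous_intros) auto
  have moment: "mint \<mu> (\<lambda>x. mat 1) (\<lambda>x. x powi (- i) *\<^sub>C (inverse (x - z) *\<^sub>C X k x)) = z powi (- i) *\<^sub>C ?I"
    if i: "i \<in> window j" for i
    unfolding cscale_simps
  proof (rule evaluate_cauchy)
    fix s assume "s \<in> {0..<- i} \<union> {- i..<0}"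
    from orthogonal[OF exponents_upper[OF i this jk]] show "mint \<mu> (\<lambda>x. mat 1) (\<lambda>x. x powi s *\<^sub>C X k x) = 0"
      by simp
  qed (intro continuous_intros z)+
  have "green z j k = (\<Sum>i\<in>window j. hadj (A j i) ** (z powi (- i) *\<^sub>C ?I))"
    unfolding green_def
    by (subst ipR_laurent_left[OF _ expansion])
      (auto intro!: continuous_intros cont sum.cong simp: moment simp del: cscale_simps)
  also have "\<dots> = hadj (X j (1 / cnj z)) ** ?I"
    using z by (simp add: expansion laurent_def hadj_sum matrix_mult_sum_left power_int_minus
        power_int_divide_distrib inverse_eq_divide)
  finally show ?thesis .
qed

lemma green_lower:
  assumes z: "z \<in> ball 0 1 - {0}" and jk: "k < j \<or> j = k \<and> odd j"
  shows "green z j k = mint \<mu> (\<lambda>x. hadj (X j x)) (\<lambda>x. inverse (x - z) *\<^sub>C mat 1) ** X k z"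
proof -
  let ?I = "mint \<mu> (\<lambda>x. hadj (X j x)) (\<lambda>x. inverse (x - z) *\<^sub>C mat 1)"
  have cont: "continuous_on (sphere 0 1) (\<lambda>x. inverse (x - z))"
    using z by (intro continuous_intros) auto
  have cont': "continuous_on (sphere 0 1) (\<lambda>x. (x powi i * inverse (x - z)) *\<^sub>C (mat 1 :: complex^'n^'n))" for i
    by (intro continuous_on_cscale continuous_on_mult continuous_on_powi_circle cont continuous_on_const)
  have moment: "mint \<mu> (\<lambda>x. hadj (X j x)) (\<lambda>x. (x powi i * inverse (x - z)) *\<^sub>C mat 1) = z powi i *\<^sub>C ?I"
    if i: "i \<in> window k" for i
  proof (rule evaluate_cauchy)
    fix s assume "s \<in> {0..<i} \<union> {i..<0}"
    from orthogonal_adjoint[OF exponents_lower[OF i this jk]]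
    show "mint \<mu> (\<lambda>x. hadj (X j x)) (\<lambda>x. x powi s *\<^sub>C mat 1) = 0" .
  qed (intro continuous_intros z)+
  have "green z j k = mint \<mu> (\<lambda>x. hadj (X j x))
      (\<lambda>x. \<Sum>i\<in>window k. ((x powi i * inverse (x - z)) *\<^sub>C mat 1) ** A k i)"
    unfolding green_def ipR_def
  proof (rule mint_cong)
    fix x :: complex assume "x \<in> sphere 0 1"
    then have "x \<noteq> 0" by auto
    then show "inverse (x - z) *\<^sub>C X k x =
        (\<Sum>i\<in>window k. ((x powi i * inverse (x - z)) *\<^sub>C mat 1) ** A k i)"
      by (simp add: expansion laurent_def cscale_sum mult.commute)
  qed simp
  also have "\<dots> = (\<Sum>i\<in>window k. (z powi i *\<^sub>C ?I) ** A k i)"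
    by (simp only: mint_sum_right mint_mult_right cont' continuous_on_basis continuous_on_hadj
        continuous_on_matrix_mult continuous_on_const moment cong: sum.cong)
  also have "\<dots> = ?I ** X k z"
    using z by (simp add: expansion laurent_def matrix_mult_sum_right)
  finally show ?thesis .
qed

end

section \<open>Second kind functions\<close>

lemma powi_times_power: "x \<noteq> 0 \<Longrightarrow> x powi i * x ^ k = x powi (i + int k)" for x :: complex
  by (simp add: power_int_add)

lemma continuous_on_mpoly [continuous_intros]: "continuous_on S (mpoly P)"
  unfolding mpoly_def by (intro continuous_intros)

lemma mpoly_monic: "monic_of_degree n P \<Longrightarrow> mpoly P x = (\<Sum>k\<le>n. x ^ k *\<^sub>C coeff P k)"
  by (simp add: mpoly_def monic_of_degree_def)

lemma invertible_if_product:
  fixes A B :: "complex^'n^'n"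
  assumes "A ** B = mat 1"
  shows "invertible A" "invertible B"
  using assms matrix_left_right_inverse unfolding invertible_def by blast+

lemma kernel_eq: "x \<noteq> z \<Longrightarrow> kernel x z = 1 + 2 * z * inverse (x - z)"
  by (simp add: kernel_def field_simps)

lemma reflect_circle: "x \<in> sphere 0 1 \<Longrightarrow> 1 / cnj x = x"
  by (simp add: cnj_circle inverse_eq_divide)

text \<open>
  On the circle \<open>cnj x = 1 / x\<close>, so reflecting \<open>z\<close> in the circle and conjugating changes only the sign
  of the kernel. This sign turns the reversed second kind polynomials into integrals of the same
  kind as the unreversed ones.
\<close>
lemma cnj_kernel_reflect:
  assumes "x \<in> sphere 0 1" "z \<in> ball 0 1 - {0}"
  shows "cnj (kernel x (1 / cnj z)) = - kernel x z"
proof -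
  have "x \<noteq> 0" "x \<noteq> z" "z \<noteq> 0" using assms by auto
  have "cnj (kernel x (1 / cnj z)) = (1 / x + 1 / z) / (1 / x - 1 / z)"
    by (simp add: kernel_def cnj_circle[OF assms(1)] inverse_eq_divide)
  also have "\<dots> = (z + x) / (z - x)"
    using \<open>x \<noteq> 0\<close> \<open>z \<noteq> 0\<close> \<open>x \<noteq> z\<close> by (simp add: divide_simps)
  also have "\<dots> = - kernel x z"
    unfolding kernel_def by (metis add.commute minus_diff_eq minus_divide_right)
  finally show ?thesis .
qed

lemma continuous_on_kernel:
  assumes "z \<notin> sphere 0 1"
  shows "continuous_on (sphere 0 1) (\<lambda>x. kernel x z)"
  unfolding kernel_def using assms by (intro continuous_intros) auto

lemma reflect_notin_circle: "z \<in> ball 0 1 - {0} \<Longrightarrow> 1 / cnj z \<notin> sphere 0 1"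
  by (auto simp: norm_divide)

context hermitian_measure
begin

lemma mint_kernel:
  assumes f: "continuous_on (sphere 0 1) f" and g: "continuous_on (sphere 0 1) g"
    and z: "z \<in> ball 0 1 - {0}"
  shows "mint \<mu> f (\<lambda>x. kernel x z *\<^sub>C g x) =
    mint \<mu> f g + (2 * z) *\<^sub>C mint \<mu> f (\<lambda>x. inverse (x - z) *\<^sub>C g x)"
proof -
  have cont: "continuous_on (sphere 0 1) (\<lambda>x. inverse (x - z))"
    using z by (intro continuous_intros) auto
  have "mint \<mu> f (\<lambda>x. kernel x z *\<^sub>C g x) =
      mint \<mu> f (\<lambda>x. g x + (2 * z) *\<^sub>C (inverse (x - z) *\<^sub>C g x))"
  proof (rule mint_cong)
    fix x :: complex assume "x \<in> sphere 0 1"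
    then have "x \<noteq> z" using z by auto
    then show "kernel x z *\<^sub>C g x = g x + (2 * z) *\<^sub>C (inverse (x - z) *\<^sub>C g x)"
      by (simp add: kernel_eq cscale_linear)
  qed simp
  also have "\<dots> = mint \<mu> f g + mint \<mu> f (\<lambda>x. (2 * z) *\<^sub>C (inverse (x - z) *\<^sub>C g x))"
    by (intro mint_add_right f g continuous_on_cscale cont continuous_on_const)
  finally show ?thesis
    by (simp only: mint_cscale_right)
qed

text \<open>
  Since \<open>(x + z) / (x - z) = 1 + 2 z / (x - z)\<close>, the kernel acts as \<open>2 z (x - z)\<^sup>-\<^sup>1\<close> on functions without
  zeroth moment; a monomial factor can then be moved under the integral.
\<close>
lemma kernel_to_cauchy:
  assumes f: "continuous_on (sphere 0 1) f" and g: "continuous_on (sphere 0 1) g"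
    and z: "z \<in> ball 0 1 - {0}"
    and orth: "\<And>s. s \<in> insert 0 ({0..<i} \<union> {i..<0}) \<Longrightarrow> mint \<mu> f (\<lambda>x. x powi s *\<^sub>C g x) = 0"
  shows "z powi i *\<^sub>C mint \<mu> f (\<lambda>x. kernel x z *\<^sub>C g x) =
    (2 * z) *\<^sub>C mint \<mu> f (\<lambda>x. inverse (x - z) *\<^sub>C (x powi i *\<^sub>C g x))"
proof -
  have "mint \<mu> f g = 0" using orth[of 0] by simp
  moreover have "mint \<mu> f (\<lambda>x. inverse (x - z) *\<^sub>C (x powi i *\<^sub>C g x)) =
      z powi i *\<^sub>C mint \<mu> f (\<lambda>x. inverse (x - z) *\<^sub>C g x)"
    using evaluate_cauchy[OF f g z, of i] orth by (simp add: mult.commute)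
  ultimately show ?thesis
    by (simp add: mint_kernel[OF f g z] mult_ac)
qed

lemma Fcar_eq: "Fcar \<mu> z = mint \<mu> (\<lambda>x. mat 1) (\<lambda>x. kernel x z *\<^sub>C mat 1)"
  unfolding Fcar_def
  by (subst mint_scalar_move[symmetric]) (simp flip: mat_eq_cscale)

text \<open>
  The second kind functions are combinations with \<open>F\<close> that become pure kernel integrals: the
  subtracted value \<open>\<phi>\<^sub>n(z)\<close> leaves the integral and produces \<open>F(z)\<close>. At index \<open>0\<close> the convention
  \<open>\<psi>\<^sub>0 = 1\<close> breaks this identity.
\<close>
lemma psiR_eq:
  assumes \<phi>: "continuous_on (sphere 0 1) (\<phi> n)" and z: "z \<notin> sphere 0 1" and n: "n \<noteq> 0"
  shows "psiR \<mu> \<phi> n z = mint \<mu> (\<lambda>x. mat 1) (\<lambda>x. kernel x z *\<^sub>C \<phi> n x) - Fcar \<mu> z ** \<phi> n z"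
proof -
  note cont = continuous_on_kernel[OF z]
  have "psiR \<mu> \<phi> n z =
      mint \<mu> (\<lambda>x. kernel x z *\<^sub>C mat 1) (\<lambda>x. \<phi> n x + mat 1 ** (- \<phi> n z))"
    using n by (simp add: psiR_def flip: mat_eq_cscale)
  also have "\<dots> = mint \<mu> (\<lambda>x. kernel x z *\<^sub>C mat 1) (\<phi> n) +
      mint \<mu> (\<lambda>x. kernel x z *\<^sub>C mat 1) (\<lambda>x. mat 1) ** (- \<phi> n z)"
    by (subst mint_add_right, (intro continuous_intros cont \<phi>)+,
        subst mint_mult_right, (intro continuous_intros cont \<phi>)+, simp)
  finally show ?thesis
    by (simp add: Fcar_eq mint_scalar_move)
qed

lemma psiL_eq:
  assumes \<phi>: "continuous_on (sphere 0 1) (\<phi> n)" and z: "z \<notin> sphere 0 1" and n: "n \<noteq> 0"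
  shows "psiL \<mu> \<phi> n z = mint \<mu> (\<phi> n) (\<lambda>x. kernel x z *\<^sub>C mat 1) - \<phi> n z ** Fcar \<mu> z"
proof -
  note cont = continuous_on_kernel[OF z]
  have "psiL \<mu> \<phi> n z =
      mint \<mu> (\<lambda>x. \<phi> n x + (- \<phi> n z) ** mat 1) (\<lambda>x. kernel x z *\<^sub>C mat 1)"
    using n by (simp add: psiL_def mint_scalar_move)
  also have "\<dots> = mint \<mu> (\<phi> n) (\<lambda>x. kernel x z *\<^sub>C mat 1) +
      (- \<phi> n z) ** mint \<mu> (\<lambda>x. mat 1) (\<lambda>x. kernel x z *\<^sub>C mat 1)"
    by (subst mint_add_left, (intro continuous_intros cont \<phi>)+,
        subst mint_mult_left, (intro continuous_intros cont \<phi>)+, simp)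
  finally show ?thesis
    by (simp add: Fcar_eq)
qed

lemma hadj_mint_kernel_reflect:
  assumes z: "z \<in> ball 0 1 - {0}"
  shows "hadj (mint \<mu> f (\<lambda>x. kernel x (1 / cnj z) *\<^sub>C g x)) =
    - mint \<mu> (\<lambda>x. hadj (g x)) (\<lambda>x. kernel x z *\<^sub>C hadj (f x))"
proof -
  have "hadj (mint \<mu> f (\<lambda>x. kernel x (1 / cnj z) *\<^sub>C g x)) =
      mint \<mu> (\<lambda>x. (- 1) *\<^sub>C (kernel x z *\<^sub>C hadj (g x))) (\<lambda>x. hadj (f x))"
    unfolding hadj_mint by (rule mint_cong) (simp_all only: hadj_simps cnj_kernel_reflect[OF _ z] cscale_simps mult_minus_left mult_1_left)
  then show ?thesis
    unfolding mint_cscale_left unfolding mint_scalar_move by (simp add: cscale_linear)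
qed

lemma hadj_Fcar_reflect:
  assumes z: "z \<in> ball 0 1 - {0}"
  shows "hadj (Fcar \<mu> (1 / cnj z)) = - Fcar \<mu> z"
  unfolding Fcar_eq hadj_mint_kernel_reflect[OF z] by simp

lemma hadj_psiR_reflect:
  assumes \<phi>: "continuous_on (sphere 0 1) (\<phi> n)" and z: "z \<in> ball 0 1 - {0}" and n: "n \<noteq> 0"
  shows "hadj (psiR \<mu> \<phi> n (1 / cnj z)) =
    hadj (\<phi> n (1 / cnj z)) ** Fcar \<mu> z - mint \<mu> (\<lambda>x. hadj (\<phi> n x)) (\<lambda>x. kernel x z *\<^sub>C mat 1)"
  unfolding psiR_eq[where \<phi> = \<phi>, OF \<phi> reflect_notin_circle[OF z] n] hadj_diff hadj_mult
    hadj_Fcar_reflect[OF z] hadj_mint_kernel_reflect[OF z] by simp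

lemma hadj_psiL_reflect:
  assumes \<phi>: "continuous_on (sphere 0 1) (\<phi> n)" and z: "z \<in> ball 0 1 - {0}" and n: "n \<noteq> 0"
  shows "hadj (psiL \<mu> \<phi> n (1 / cnj z)) =
    Fcar \<mu> z ** hadj (\<phi> n (1 / cnj z)) - mint \<mu> (\<lambda>x. mat 1) (\<lambda>x. kernel x z *\<^sub>C hadj (\<phi> n x))"
  unfolding psiL_eq[where \<phi> = \<phi>, OF \<phi> reflect_notin_circle[OF z] n] hadj_diff hadj_mult
    hadj_Fcar_reflect[OF z] hadj_mint_kernel_reflect[OF z] by simp

end

section \<open>The CMV basis and its resolvent\<close>

locale orthogonal_polynomials_on_circle = hermitian_measure \<mu> for \<mu> :: "complex set \<Rightarrow> complex^'n^'n" +
  fixes \<Phi>L \<Phi>R :: "nat \<Rightarrow> (complex^'n^'n) poly" and \<kappa>L \<kappa>R :: "nat \<Rightarrow> complex^'n^'n"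
  assumes mass: "\<mu> (sphere 0 1) = mat 1"
    and monic_L: "monic_orthogonal_L \<mu> \<Phi>L" and monic_R: "monic_orthogonal_R \<mu> \<Phi>R"
    and norm_L: "normalization_L \<mu> \<Phi>L \<kappa>L" and norm_R: "normalization_R \<mu> \<Phi>R \<kappa>R"
begin

abbreviation "\<phi>L \<equiv> orthonormal_L \<Phi>L \<kappa>L"
abbreviation "\<phi>R \<equiv> orthonormal_R \<Phi>R \<kappa>R"
abbreviation "\<xi> \<equiv> chi \<phi>L \<phi>R"

lemma continuous_on_\<phi> [continuous_intros]:
  "continuous_on (sphere 0 1) (\<phi>L n)" "continuous_on (sphere 0 1) (\<phi>R n)"
  unfolding orthonormal_L_def orthonormal_R_def by (intro continuous_intros)+

lemma \<phi>_eta: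
  "\<phi>L n = (\<lambda>x. \<kappa>L n ** mpoly (\<Phi>L n) x)" "\<phi>R n = (\<lambda>x. mpoly (\<Phi>R n) x ** \<kappa>R n)"
  by (simp_all add: fun_eq_iff orthonormal_L_def orthonormal_R_def)

lemma \<phi>L_expand: "\<phi>L n x = (\<Sum>k\<le>n. x ^ k *\<^sub>C (\<kappa>L n ** coeff (\<Phi>L n) k))"
  using monic_L by (simp add: orthonormal_L_def monic_orthogonal_L_def mpoly_monic[of n] matrix_mult_sum_right)

lemma \<phi>R_expand: "\<phi>R n x = (\<Sum>k\<le>n. x ^ k *\<^sub>C (coeff (\<Phi>R n) k ** \<kappa>R n))"
  using monic_R by (simp add: orthonormal_R_def monic_orthogonal_R_def mpoly_monic[of n] matrix_mult_sum_left)

lemma \<phi>_zero: "\<phi>L 0 x = mat 1" 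
  using monic_L norm_L
  by (simp add: \<phi>L_expand monic_orthogonal_L_def monic_of_degree_def normalization_L_def)

text \<open>
  The normalization exhibits \<open>\<kappa>\<^sub>n\<close> as a factor of the identity.
\<close>
lemma invertible_\<kappa>: "invertible (\<kappa>L n)" "invertible (\<kappa>R n)"
proof -
  have "mat 1 = mint \<mu> (\<lambda>x. \<kappa>L n ** mpoly (\<Phi>L n) x) (\<lambda>x. hadj (\<phi>L n x))"
    using norm_L unfolding normalization_L_def ipL_def \<phi>_eta[symmetric] by metis
  also have "\<dots> = \<kappa>L n ** mint \<mu> (mpoly (\<Phi>L n)) (\<lambda>x. hadj (\<phi>L n x))"
    by (intro mint_mult_left continuous_intros)
  finally show "invertible (\<kappa>L n)"
    using invertible_if_product by metis
  have "mat 1 = mint \<mu> (\<lambda>x. hadj (\<phi>R n x)) (\<lambda>x. mpoly (\<Phi>R n) x ** \<kappa>R n)"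
    using norm_R unfolding normalization_R_def ipR_def \<phi>_eta[symmetric] by metis
  also have "\<dots> = mint \<mu> (\<lambda>x. hadj (\<phi>R n x)) (mpoly (\<Phi>R n)) ** \<kappa>R n"
    by (intro mint_mult_right continuous_intros)
  finally show "invertible (\<kappa>R n)"
    using invertible_if_product by metis
qed

lemma \<phi>R_orthogonal:
  assumes "0 \<le> s" "s < int n"
  shows "mint \<mu> (\<lambda>x. mat 1) (\<lambda>x. x powi (- s) *\<^sub>C \<phi>R n x) = 0"
    and "mint \<mu> (\<lambda>x. hadj (\<phi>R n x)) (\<lambda>x. x powi s *\<^sub>C mat 1) = 0"
proof -
  have "0 = ipR \<mu> (\<lambda>z. mat (z ^ nat s)) (mpoly (\<Phi>R n))"
    using monic_R assms by (simp add: monic_orthogonal_R_def)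
  also have "\<dots> = mint \<mu> (\<lambda>x. x powi (- s) *\<^sub>C mat 1) (mpoly (\<Phi>R n))"
    unfolding ipR_def
  proof (rule mint_cong)
    fix x :: complex assume "x \<in> sphere 0 1"
    then show "hadj (mat (x ^ nat s)) = x powi (- s) *\<^sub>C (mat 1 :: complex^'n^'n)"
      using cnj_powi_circle[of x s] assms(1)
      by (simp add: power_int_def flip: mat_eq_cscale)
  qed simp
  finally have "0 = mint \<mu> (\<lambda>x. x powi (- s) *\<^sub>C mat 1) (mpoly (\<Phi>R n)) ** \<kappa>R n"
    by simp
  also have "\<dots> = mint \<mu> (\<lambda>x. mat 1) (\<lambda>x. x powi (- s) *\<^sub>C \<phi>R n x)"
    by (subst mint_mult_right[symmetric]) (auto intro!: continuous_intros simp: mint_scalar_move simp flip: \<phi>_eta)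
  finally show *: "mint \<mu> (\<lambda>x. mat 1) (\<lambda>x. x powi (- s) *\<^sub>C \<phi>R n x) = 0" ..
  have "mint \<mu> (\<lambda>x. hadj (\<phi>R n x)) (\<lambda>x. x powi s *\<^sub>C mat 1) =
      mint \<mu> (\<lambda>x. hadj (x powi (- s) *\<^sub>C \<phi>R n x)) (\<lambda>x. hadj (mat 1))"
    by (subst mint_scalar_move[symmetric], rule mint_cong)
      (simp_all add: cnj_powi_circle del: complex_cnj_power_int)
  then show "mint \<mu> (\<lambda>x. hadj (\<phi>R n x)) (\<lambda>x. x powi s *\<^sub>C mat 1) = 0"
    unfolding hadj_mint[symmetric] * by simp
qed

lemma \<phi>L_orthogonal:
  assumes "0 \<le> s" "s < int n"
  shows "mint \<mu> (\<phi>L n) (\<lambda>x. x powi (- s) *\<^sub>C mat 1) = 0"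
    and "mint \<mu> (\<lambda>x. mat 1) (\<lambda>x. x powi s *\<^sub>C hadj (\<phi>L n x)) = 0"
proof -
  have "0 = ipL \<mu> (\<lambda>z. mat (z ^ nat s)) (mpoly (\<Phi>L n))"
    using monic_L assms by (simp add: monic_orthogonal_L_def)
  also have "\<dots> = mint \<mu> (mpoly (\<Phi>L n)) (\<lambda>x. x powi (- s) *\<^sub>C mat 1)"
    unfolding ipL_def
  proof (rule mint_cong)
    fix x :: complex assume "x \<in> sphere 0 1"
    then show "hadj (mat (x ^ nat s)) = x powi (- s) *\<^sub>C (mat 1 :: complex^'n^'n)"
      using cnj_powi_circle[of x s] assms(1)
      by (simp add: power_int_def flip: mat_eq_cscale)
  qed simp
  finally have "0 = \<kappa>L n ** mint \<mu> (mpoly (\<Phi>L n)) (\<lambda>x. x powi (- s) *\<^sub>C mat 1)"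
    by simp
  also have "\<dots> = mint \<mu> (\<phi>L n) (\<lambda>x. x powi (- s) *\<^sub>C mat 1)"
    by (subst mint_mult_left[symmetric]) (auto intro!: continuous_intros simp flip: \<phi>_eta)
  finally show *: "mint \<mu> (\<phi>L n) (\<lambda>x. x powi (- s) *\<^sub>C mat 1) = 0" ..
  have "mint \<mu> (\<lambda>x. mat 1) (\<lambda>x. x powi s *\<^sub>C hadj (\<phi>L n x)) =
      mint \<mu> (\<lambda>x. hadj (x powi (- s) *\<^sub>C mat 1)) (\<lambda>x. hadj (\<phi>L n x))"
    by (subst mint_scalar_move[symmetric], rule mint_cong)
      (simp_all add: cnj_powi_circle del: complex_cnj_power_int)
  then show "mint \<mu> (\<lambda>x. mat 1) (\<lambda>x. x powi s *\<^sub>C hadj (\<phi>L n x)) = 0"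
    unfolding hadj_mint[symmetric] * by simp
qed

lemma chi_even:
  assumes "x \<noteq> 0"
  shows "\<xi> (2 * m) x = x powi int m *\<^sub>C hadj (\<phi>L (2 * m) (1 / cnj x))"
proof -
  have "x powi (- int m) * x ^ (2 * m) = x powi int m"
    using powi_times_power[OF assms, of "- int m" "2 * m"] by simp
  then show ?thesis
    by (simp add: chi_def reversed_def)
qed

lemma chi_odd: "\<xi> (Suc (2 * m)) x = x powi (- int m) *\<^sub>C \<phi>R (Suc (2 * m)) x"
  by (simp add: chi_def)

text \<open>
  The coefficient of \<open>x\<^sup>i\<close> in the \<open>n\<close>-th CMV basis function. Reversal in the even case runs through
  the coefficients of \<open>\<phi>\<^sup>L\<^sub>n\<close> backwards.
\<close>
definition chi_coeff :: "nat \<Rightarrow> int \<Rightarrow> complex^'n^'n" where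
  "chi_coeff n i =
     (if even n then hadj (\<kappa>L n ** coeff (\<Phi>L n) (nat (int (n div 2) - i)))
      else coeff (\<Phi>R n) (nat (i + int (n div 2))) ** \<kappa>R n)"

lemma chi_laurent:
  assumes x: "x \<noteq> 0"
  shows "\<xi> n x = laurent n (chi_coeff n) x"
proof (cases "even n")
  case True
  then obtain m where n: "n = 2 * m" by (elim evenE)
  have "\<xi> n x = (\<Sum>k\<le>2 * m. x powi (int m - int k) *\<^sub>C hadj (\<kappa>L n ** coeff (\<Phi>L n) k))"
    using x by (simp add: n chi_even \<phi>L_expand hadj_sum cscale_sum power_int_diff power_divide)
  also have "\<dots> = laurent n (chi_coeff n) x"
    unfolding laurent_def
    by (rule sum.reindex_bij_witness[of _ "\<lambda>i. nat (int m - i)" "\<lambda>k. int m - int k"])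
      (auto simp: n window_def chi_coeff_def)
  finally show ?thesis .
next
  case False
  then obtain m where n: "n = Suc (2 * m)" by (auto elim: oddE)
  have "\<xi> n x = (\<Sum>k\<le>Suc (2 * m). x powi (int k - int m) *\<^sub>C (coeff (\<Phi>R n) k ** \<kappa>R n))"
    unfolding n chi_odd \<phi>R_expand cscale_sum
    using x by (intro sum.cong refl) (simp add: power_int_diff power_int_minus divide_inverse mult.commute)
  also have "\<dots> = laurent n (chi_coeff n) x"
    unfolding laurent_def
    by (rule sum.reindex_bij_witness[of _ "\<lambda>i. nat (i + int m)" "\<lambda>k. int k - int m"])
      (auto simp: n window_def chi_coeff_def)
  finally show ?thesis .
qed

lemma chi_circle:
  assumes "x \<in> sphere 0 1"
  shows "\<xi> (2 * m) x = x powi int m *\<^sub>C hadj (\<phi>L (2 * m) x)"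
proof -
  have "x \<noteq> 0" using assms by auto
  then show ?thesis by (simp add: chi_even reflect_circle[OF assms])
qed

sublocale laurent_basis \<mu> \<xi> chi_coeff
proof
  show "\<xi> n x = laurent n (chi_coeff n) x" if "x \<noteq> 0" for n x
    using that by (rule chi_laurent)
  show "invertible (chi_coeff n (new_exponent n))" for n
  proof (cases "even n")
    case True
    then have "nat (int (n div 2) - new_exponent n) = n"
      by (auto simp: new_exponent_def elim: evenE)
    then show ?thesis
      using True monic_L invertible_hadj[OF invertible_\<kappa>(1)[of n]]
      by (simp add: chi_coeff_def monic_orthogonal_L_def monic_of_degree_def)
  next
    case False
    then have "nat (new_exponent n + int (n div 2)) = n"
      by (auto simp: new_exponent_def elim: oddE)
    then show ?thesis
      using False monic_R invertible_\<kappa>(2)[of n]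
      by (simp add: chi_coeff_def monic_orthogonal_R_def monic_of_degree_def)
  qed
  show "mint \<mu> (\<lambda>x. mat 1) (\<lambda>x. x powi (- i) *\<^sub>C \<xi> n x) = 0"
    if i: "i \<in> window n - {new_exponent n}" for i n
  proof (cases "even n")
    case True
    then obtain m where n: "n = 2 * m" by (elim evenE)
    have "mint \<mu> (\<lambda>x. mat 1) (\<lambda>x. x powi (- i) *\<^sub>C \<xi> n x) =
        mint \<mu> (\<lambda>x. mat 1) (\<lambda>x. x powi (int m - i) *\<^sub>C hadj (\<phi>L n x))"
    proof (rule mint_cong)
      fix x :: complex assume x: "x \<in> sphere 0 1"
      then have "x \<noteq> 0" by auto
      then show "x powi (- i) *\<^sub>C \<xi> n x = x powi (int m - i) *\<^sub>C hadj (\<phi>L n x)"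
        unfolding n chi_circle[OF x] by (simp add: power_int_diff power_int_minus divide_inverse mult.commute)
    qed simp
    also have "\<dots> = 0"
      using i by (intro \<phi>L_orthogonal(2)) (auto simp: n window_def new_exponent_def)
    finally show ?thesis .
  next
    case False
    then obtain m where n: "n = Suc (2 * m)" by (auto elim: oddE)
    have "mint \<mu> (\<lambda>x. mat 1) (\<lambda>x. x powi (- i) *\<^sub>C \<xi> n x) =
        mint \<mu> (\<lambda>x. mat 1) (\<lambda>x. x powi (- (i + int m)) *\<^sub>C \<phi>R n x)"
    proof (rule mint_cong)
      fix x :: complex assume x: "x \<in> sphere 0 1"
      then have "x \<noteq> 0" by auto
      then show "x powi (- i) *\<^sub>C \<xi> n x = x powi (- (i + int m)) *\<^sub>C \<phi>R n x"
        unfolding n chi_odd by (simp add: power_int_diff power_int_minus divide_inverse)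
    qed simp
    also have "\<dots> = 0"
      using i by (intro \<phi>R_orthogonal(1)) (auto simp: n window_def new_exponent_def)
    finally show ?thesis .
  qed
  show "ipR \<mu> (\<xi> n) (\<xi> n) = mat 1" for n
  proof (cases "even n")
    case True
    then obtain m where n: "n = 2 * m" by (elim evenE)
    have "ipR \<mu> (\<xi> n) (\<xi> n) =
        ipR \<mu> (\<lambda>x. x powi int m *\<^sub>C hadj (\<phi>L n x)) (\<lambda>x. x powi int m *\<^sub>C hadj (\<phi>L n x))"
      unfolding ipR_def by (rule mint_cong) (simp_all only: n chi_circle)
    also have "\<dots> = ipL \<mu> (\<phi>L n) (\<phi>L n)"
      unfolding ipR_powi_move ipR_unimodular_cancel by (simp add: ipR_def ipL_def)
    finally show ?thesis
      using norm_L by (simp add: normalization_L_def)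
  next
    case False
    then obtain m where n: "n = Suc (2 * m)" by (auto elim: oddE)
    have "ipR \<mu> (\<xi> n) (\<xi> n) = ipR \<mu> (\<phi>R n) (\<phi>R n)"
      unfolding n chi_odd ipR_powi_move ipR_unimodular_cancel ..
    then show ?thesis
      using norm_R by (simp add: normalization_R_def)
  qed
qed

lemma CMV_eq_mult_matrix: "CMV \<mu> \<phi>L \<phi>R = mult_matrix 1"
  by (simp add: fun_eq_iff CMV_def mult_matrix_def)

text \<open>
  \<open>\<pi>\<^sub>k\<close> is \<open>2 z\<close> times the Cauchy integral of the basis function. Adding \<open>F \<chi>\<^sub>k\<close> cancels the \<open>F\<close>-term of
  the second kind function and leaves a kernel integral; orthogonality of \<open>\<phi>\<^sub>k\<close> then moves the
  monomial prefactor inside. The index \<open>0\<close> is separate: there the zeroth moment is \<open>\<mu>(sphere 0 1) = 1\<close>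
  instead of \<open>0\<close>, and it cancels against \<open>\<Upsilon>\<^sub>0 = -1\<close>.
\<close>
lemma pifun_eq:
  assumes z: "z \<in> ball 0 1 - {0}"
  shows "pifun \<mu> \<phi>L \<phi>R k z =
    (2 * z) *\<^sub>C mint \<mu> (\<lambda>x. mat 1) (\<lambda>x. inverse (x - z) *\<^sub>C \<xi> k x)"
proof -
  have "z \<noteq> 0" and out: "z \<notin> sphere 0 1" using z by auto
  have "k = 0 \<or> (\<exists>m. k = 2 * m \<and> m > 0) \<or> (\<exists>m. k = Suc (2 * m))"
    by presburger
  then consider "k = 0" | m where "k = 2 * m" "m > 0" | m where "k = Suc (2 * m)"
    by blast
  then show ?thesis
  proof cases
    case 1
    have "\<xi> 0 x = mat 1" for x
      by (simp add: chi_def reversed_def \<phi>_zero)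
    moreover have "Upsilon \<mu> \<phi>L \<phi>R 0 z = - mat 1"
      by (simp add: Upsilon_def reversed_def psiL_def)
    moreover have "mint \<mu> (\<lambda>x. mat 1) (\<lambda>x. kernel x z *\<^sub>C mat 1) =
        mat 1 + (2 * z) *\<^sub>C mint \<mu> (\<lambda>x. mat 1) (\<lambda>x. inverse (x - z) *\<^sub>C mat 1)"
      by (subst mint_kernel[OF _ _ z]) (simp_all add: mint_one mass)
    ultimately show ?thesis
      by (simp add: 1 pifun_def Fcar_eq)
  next
    case (2 m)
    have "z powi (- int m) * z ^ (2 * m) = z powi int m"
      using powi_times_power[OF \<open>z \<noteq> 0\<close>, of "- int m" "2 * m"] by simp
    then have "Upsilon \<mu> \<phi>L \<phi>R k z = - (z powi int m *\<^sub>C hadj (psiL \<mu> \<phi>L k (1 / cnj z)))"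
      by (simp add: Upsilon_def reversed_def 2)
    then have "pifun \<mu> \<phi>L \<phi>R k z =
        z powi int m *\<^sub>C mint \<mu> (\<lambda>x. mat 1) (\<lambda>x. kernel x z *\<^sub>C hadj (\<phi>L k x))"
      using 2 \<open>z \<noteq> 0\<close>
      by (simp add: pifun_def hadj_psiL_reflect[OF _ z] chi_even continuous_intros cscale_linear)
    also have "\<dots> = (2 * z) *\<^sub>C mint \<mu> (\<lambda>x. mat 1)
        (\<lambda>x. inverse (x - z) *\<^sub>C (x powi int m *\<^sub>C hadj (\<phi>L k x)))"
      using \<open>m > 0\<close>
      by (intro kernel_to_cauchy continuous_intros z \<phi>L_orthogonal(2)) (auto simp: 2)
    also have "\<dots> = (2 * z) *\<^sub>C mint \<mu> (\<lambda>x. mat 1) (\<lambda>x. inverse (x - z) *\<^sub>C \<xi> k x)"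
      by (intro arg_cong[where f = "\<lambda>M. (2 * z) *\<^sub>C M"] mint_cong) (simp_all only: 2 chi_circle)
    finally show ?thesis .
  next
    case (3 m)
    have "pifun \<mu> \<phi>L \<phi>R k z =
        z powi (- int m) *\<^sub>C mint \<mu> (\<lambda>x. mat 1) (\<lambda>x. kernel x z *\<^sub>C \<phi>R k x)"
      by (simp add: pifun_def Upsilon_def psiR_eq[OF _ out] chi_def continuous_intros cscale_linear 3)
    also have "\<dots> = (2 * z) *\<^sub>C mint \<mu> (\<lambda>x. mat 1)
        (\<lambda>x. inverse (x - z) *\<^sub>C (x powi (- int m) *\<^sub>C \<phi>R k x))"
    proof (intro kernel_to_cauchy continuous_intros z)
      fix s assume "s \<in> insert 0 ({0..<- int m} \<union> {- int m..<0})"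
      then show "mint \<mu> (\<lambda>x. mat 1) (\<lambda>x. x powi s *\<^sub>C \<phi>R k x) = 0"
        using \<phi>R_orthogonal(1)[of "- s" k] by (auto simp: 3)
    qed
    finally show ?thesis
      by (simp only: 3 chi_odd)
  qed
qed

text \<open>
  At \<open>j = 0\<close> the identity fails: \<open>y\<^sub>0\<close> has the opposite sign to \<open>\<Upsilon>\<^sub>0\<close>, so the zeroth moment is doubled
  instead of cancelled. The resolvent formula uses \<open>p\<^sub>j\<close> only for \<open>j > k\<close> or odd \<open>j = k\<close>.
\<close>
lemma pfun_eq:
  assumes z: "z \<in> ball 0 1 - {0}" and j: "j > 0"
  shows "pfun \<mu> \<phi>L \<phi>R j z =
    (2 * z) *\<^sub>C mint \<mu> (\<lambda>x. hadj (\<xi> j x)) (\<lambda>x. inverse (x - z) *\<^sub>C mat 1)"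
proof -
  have "z \<noteq> 0" and out: "z \<notin> sphere 0 1" using z by auto
  have reflect: "mint \<mu> (\<lambda>x. hadj (\<xi> j x)) (\<lambda>x. inverse (x - z) *\<^sub>C mat 1) =
      mint \<mu> f (\<lambda>x. inverse (x - z) *\<^sub>C (x powi i *\<^sub>C mat 1))"
    if "\<And>x. x \<in> sphere 0 1 \<Longrightarrow> hadj (\<xi> j x) = x powi i *\<^sub>C f x" for f i
    unfolding cscale_simps(4) 
    by (subst mint_cong[OF that refl]) (simp_all add: mint_scalar_move mult.commute)
  have "(\<exists>m. j = 2 * m \<and> m > 0) \<or> (\<exists>m. j = Suc (2 * m))"
    using j by presburger
  then consider m where "j = 2 * m" "m > 0" | m where "j = Suc (2 * m)"
    by blast
  then show ?thesis
  proof cases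
    case (1 m)
    have "pfun \<mu> \<phi>L \<phi>R j z =
        z powi (- int m) *\<^sub>C mint \<mu> (\<phi>L j) (\<lambda>x. kernel x z *\<^sub>C mat 1)"
      using 1 \<open>z \<noteq> 0\<close>
      by (simp add: pfun_def yfun_def xtilde_def psiL_eq[OF _ out] chi_even continuous_intros
          cscale_linear power_int_minus power_int_divide_distrib inverse_eq_divide
          power_one_over)
    also have "\<dots> = (2 * z) *\<^sub>C mint \<mu> (\<phi>L j)
        (\<lambda>x. inverse (x - z) *\<^sub>C (x powi (- int m) *\<^sub>C mat 1))"
    proof (intro kernel_to_cauchy continuous_intros z)
      fix s assume "s \<in> insert 0 ({0..<- int m} \<union> {- int m..<0})"
      then show "mint \<mu> (\<phi>L j) (\<lambda>x. x powi s *\<^sub>C mat 1) = 0"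
        using \<phi>L_orthogonal(1)[of "- s" j] \<open>m > 0\<close> by (auto simp: 1)
    qed
    finally have "pfun \<mu> \<phi>L \<phi>R j z = (2 * z) *\<^sub>C mint \<mu> (\<phi>L j)
        (\<lambda>x. inverse (x - z) *\<^sub>C (x powi (- int m) *\<^sub>C mat 1))" .
    moreover have "hadj (\<xi> j x) = x powi (- int m) *\<^sub>C \<phi>L j x" if "x \<in> sphere 0 1" for x
      unfolding 1 chi_circle[OF that] hadj_simps cnj_powi_circle[OF that] ..
    ultimately show ?thesis
      by (simp only: reflect[of "- int m" "\<phi>L j"])
  next
    case (2 m)
    have "z powi (- int (Suc m)) * z ^ Suc (2 * m) = z powi int m"
      using powi_times_power[OF \<open>z \<noteq> 0\<close>, of "- int (Suc m)" "Suc (2 * m)"]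
      by (simp del: power_Suc)
    then have "yfun \<mu> \<phi>L \<phi>R j z = - (z powi int m *\<^sub>C hadj (psiR \<mu> \<phi>R j (1 / cnj z)))"
      by (simp add: yfun_def reversed_def 2)
    then have "pfun \<mu> \<phi>L \<phi>R j z =
        z powi int m *\<^sub>C mint \<mu> (\<lambda>x. hadj (\<phi>R j x)) (\<lambda>x. kernel x z *\<^sub>C mat 1)"
      using \<open>z \<noteq> 0\<close>
      by (simp add: 2 pfun_def xtilde_def hadj_psiR_reflect[OF _ z] chi_odd continuous_intros
          cscale_linear power_int_minus power_int_divide_distrib inverse_eq_divide
          power_one_over)
    also have "\<dots> = (2 * z) *\<^sub>C mint \<mu> (\<lambda>x. hadj (\<phi>R j x))
        (\<lambda>x. inverse (x - z) *\<^sub>C (x powi int m *\<^sub>C mat 1))"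
      by (intro kernel_to_cauchy continuous_intros z \<phi>R_orthogonal(2)) (auto simp: 2)
    finally have "pfun \<mu> \<phi>L \<phi>R j z = (2 * z) *\<^sub>C mint \<mu> (\<lambda>x. hadj (\<phi>R j x))
        (\<lambda>x. inverse (x - z) *\<^sub>C (x powi int m *\<^sub>C mat 1))" .
    moreover have "hadj (\<xi> j x) = x powi int m *\<^sub>C hadj (\<phi>R j x)" if "x \<in> sphere 0 1" for x
      unfolding 2 chi_odd hadj_simps cnj_powi_circle[OF that] minus_minus ..
    ultimately show ?thesis
      by (simp only: reflect[of "int m" "\<lambda>x. hadj (\<phi>R j x)"])
  qed
qed

lemma cmv_resolvent:
  assumes z: "z \<in> ball 0 1 - {0}"
  shows "bij_betw (shifted_op (matrix_op (CMV \<mu> \<phi>L \<phi>R)) z) ell2 ell2"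
    and "op_block (resolvent (matrix_op (CMV \<mu> \<phi>L \<phi>R)) z) j k =
      (if k > j \<or> (j = k \<and> even j)
       then (1 / (2 * z)) *\<^sub>C (xtilde \<phi>L \<phi>R j z ** pifun \<mu> \<phi>L \<phi>R k z)
       else (1 / (2 * z)) *\<^sub>C (pfun \<mu> \<phi>L \<phi>R j z ** \<xi> k z))"
proof -
  have "norm z < 1" "z \<noteq> 0" using z by auto
  then show "bij_betw (shifted_op (matrix_op (CMV \<mu> \<phi>L \<phi>R)) z) ell2 ell2"
    unfolding CMV_eq_mult_matrix by (intro cmv.shifted_op_bij)
  have "op_block (resolvent (matrix_op (CMV \<mu> \<phi>L \<phi>R)) z) j k = green z j k"
    unfolding CMV_eq_mult_matrix by (rule op_block_resolvent) fact
  also have "\<dots> = (if k > j \<or> (j = k \<and> even j)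
       then (1 / (2 * z)) *\<^sub>C (xtilde \<phi>L \<phi>R j z ** pifun \<mu> \<phi>L \<phi>R k z)
       else (1 / (2 * z)) *\<^sub>C (pfun \<mu> \<phi>L \<phi>R j z ** \<xi> k z))"
  proof (cases "k > j \<or> (j = k \<and> even j)")
    case True
    then show ?thesis
      using \<open>z \<noteq> 0\<close> by (simp only: green_upper[OF z True] pifun_eq[OF z] xtilde_def) simp
  next
    case False
    then have jk: "k < j \<or> j = k \<and> odd j" by auto
    then have "j > 0" by (auto intro: odd_pos)
    then show ?thesis
      using \<open>z \<noteq> 0\<close> False by (simp only: green_lower[OF z jk] pfun_eq[OF z]) simp
  qed
  finally show "op_block (resolvent (matrix_op (CMV \<mu> \<phi>L \<phi>R)) z) j k = \<dots>" .
qed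

end

theorem theorem3p24:
  fixes \<mu> :: "complex set \<Rightarrow> complex^'l^'l"
    and \<Phi>L \<Phi>R :: "nat \<Rightarrow> (complex^'l^'l) poly"
    and \<kappa>L \<kappa>R :: "nat \<Rightarrow> complex^'l^'l"
    and \<phi>L \<phi>R :: "nat \<Rightarrow> complex \<Rightarrow> complex^'l^'l"
    and z :: complex and j k :: nat
  assumes "matrix_measure \<mu>" and "\<mu> (sphere 0 1) = mat 1" and "nontrivial_measure \<mu>"
    and "monic_orthogonal_L \<mu> \<Phi>L" and "monic_orthogonal_R \<mu> \<Phi>R"
    and "normalization_L \<mu> \<Phi>L \<kappa>L" and "normalization_R \<mu> \<Phi>R \<kappa>R"
    and "\<phi>L = orthonormal_L \<Phi>L \<kappa>L" and "\<phi>R = orthonormal_R \<Phi>R \<kappa>R"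
    and "z \<in> ball 0 1 - {0}"
  shows "bij_betw (shifted_op (matrix_op (CMV \<mu> \<phi>L \<phi>R)) z) ell2 ell2 \<and>
    op_block (resolvent (matrix_op (CMV \<mu> \<phi>L \<phi>R)) z) j k =
      (if k > j \<or> (j = k \<and> even j)
       then (1 / (2 * z)) *\<^sub>C (xtilde \<phi>L \<phi>R j z ** pifun \<mu> \<phi>L \<phi>R k z)
       else (1 / (2 * z)) *\<^sub>C (pfun \<mu> \<phi>L \<phi>R j z ** chi \<phi>L \<phi>R k z))"
proof -
  interpret orthogonal_polynomials_on_circle \<mu> \<Phi>L \<Phi>R \<kappa>L \<kappa>R
    by standard (fact assms)+
  show ?thesis
    unfolding assms(8,9) using cmv_resolvent[OF assms(10)] by blast
qed

end
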